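(* Let $\mathbf{SkeLC}$ be the category of all locally compact Hausdorff spaces and all continuous skeletal maps between them. Let $\mathbf{DSkeLC}$ be the category whose objects are all complete local contact algebras and whose morphisms $\varphi:(A,\rho,\mathbb{B})\to(B,\eta,\mathbb{B}')$ are all complete Boolean homomorphisms $\varphi:A\to B$ satisfying (L1) for all $a,b\in A$, $\varphi(a)\,\eta\,\varphi(b)$ implies $a\,\rho\,b$; and (L2) $b\in\mathbb{B}'$ implies $\varphi_\Lambda(b)\in\mathbb{B}$. Then the categories $\mathbf{SkeLC}$ and $\mathbf{DSkeLC}$ are dually equivalent.
   Context: A function $f:X\to Y$ between topological spaces is skeletal if $\mathrm{int}(f^{-1}(\mathrm{cl}(V)))\subseteq \mathrm{cl}(f^{-1}(V))$ for every open $V\subseteq Y$. Maps are not assumed to be onto. A contact algebra $(B,C)$ is a Boolean algebra $B=(B,0,1,\vee,\wedge,{}^* )$ ($0=1$ is allowed; $^*$ is complement) with a binary relation $C$ on $B$ such that: (C1) $a\neq 0$ implies $aCa$; (C2) $aCb$ implies $a\ne 0$ and $b\neq 0$; (C3) $aCb$ implies $bCa$; (C4) $aC(b\vee c)$ iff $aCb$ or $aCc$. Write $a\ll_C b$ iff not $aCb^*$. A local contact algebra $(B,\rho,\mathbb{B})$ consists of a contact algebra $(B,\rho)$ and an ideal $\mathbb{B}$ of $B$ (possibly non-proper) such that: (BC1) if $a\in\mathbb{B}$, $c\in B$ and $a\ll_\rho c$ then $a\ll_\rho b\ll_\rho c$ for some $b\in\mathbb{B}$; (BC2) if $a\rho b$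 then there is $c\in\mathbb{B}$ with $a\rho(c\wedge b)$; (BC3) if $a\ne 0$ then there is $b\in\mathbb{B}\setminus\{0\}$ with $b\ll_\rho a$. It is complete if $B$ is a complete Boolean algebra. A complete Boolean homomorphism is one preserving all joins and meets. For such $\varphi:A\to B$, $\varphi_\Lambda:B\to A$ denotes its left adjoint: $b\le\varphi(a)$ iff $\varphi_\Lambda(b)\le a$. Composition of morphisms is composition of functions. Two categories are dually equivalent if one is equivalent to the opposite of the other. *)

theory Defs
  imports
    "HOL-Analysis.Abstract_Topological_Spaces"
    "HOL-Algebra.Complete_Lattice"
begin

unbundle cardinal_syntax

no_notation eq_closure_of (\<open>closure'_of\<index>\<close>)  \<comment> \<open>clashes with the topological closure\<close>

section \<open>Categories, functors and dual equivalence\<close>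

text \<open>Hom-sets of different pairs of objects may overlap, so composition and the morphism part
  of a functor receive the objects involved: \<open>Cmp C X Y Z g f\<close> is the composite of
  \<open>f : X \<rightarrow> Y\<close> and \<open>g : Y \<rightarrow> Z\<close>.\<close>

record ('o, 'm) cat =
  Ob :: "'o set"
  Hom :: "'o \<Rightarrow> 'o \<Rightarrow> 'm set"
  Idt :: "'o \<Rightarrow> 'm"
  Cmp :: "'o \<Rightarrow> 'o \<Rightarrow> 'o \<Rightarrow> 'm \<Rightarrow> 'm \<Rightarrow> 'm"

locale category =
  fixes C :: "('o, 'm) cat"
  assumes id_in_Hom: "X \<in> Ob C \<Longrightarrow> Idt C X \<in> Hom C X X"
    and comp_in_Hom:
      "\<lbrakk>X \<in> Ob C; Y \<in> Ob C; Z \<in> Ob C; f \<in> Hom C X Y; g \<in> Hom C Y Z\<rbrakk>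
        \<Longrightarrow> Cmp C X Y Z g f \<in> Hom C X Z"
    and comp_id_right:
      "\<lbrakk>X \<in> Ob C; Y \<in> Ob C; f \<in> Hom C X Y\<rbrakk> \<Longrightarrow> Cmp C X X Y f (Idt C X) = f"
    and comp_id_left:
      "\<lbrakk>X \<in> Ob C; Y \<in> Ob C; f \<in> Hom C X Y\<rbrakk> \<Longrightarrow> Cmp C X Y Y (Idt C Y) f = f"
    and comp_assoc:
      "\<lbrakk>W \<in> Ob C; X \<in> Ob C; Y \<in> Ob C; Z \<in> Ob C;
        f \<in> Hom C W X; g \<in> Hom C X Y; h \<in> Hom C Y Z\<rbrakk>
        \<Longrightarrow> Cmp C W X Z (Cmp C X Y Z h g) f = Cmp C W Y Z h (Cmp C W X Y g f)"

definition opposite :: "('o, 'm) cat \<Rightarrow> ('o, 'm) cat" where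
  "opposite C = \<lparr>Ob = Ob C, Hom = (\<lambda>X Y. Hom C Y X), Idt = Idt C,
                 Cmp = (\<lambda>X Y Z g f. Cmp C Z Y X f g)\<rparr>"

definition Iso :: "('o, 'm) cat \<Rightarrow> 'o \<Rightarrow> 'o \<Rightarrow> 'm set" where
  "Iso C X Y = {f \<in> Hom C X Y. \<exists>g \<in> Hom C Y X.
                  Cmp C X Y X g f = Idt C X \<and> Cmp C Y X Y f g = Idt C Y}"

record ('o, 'm, 'p, 'n) cfunctor =
  fob :: "'o \<Rightarrow> 'p"
  fmor :: "'o \<Rightarrow> 'o \<Rightarrow> 'm \<Rightarrow> 'n"

definition is_functor ::
  "('o, 'm) cat \<Rightarrow> ('p, 'n) cat \<Rightarrow> ('o, 'm, 'p, 'n) cfunctor \<Rightarrow> bool" where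
  "is_functor C D F \<longleftrightarrow>
     (\<forall>X \<in> Ob C. fob F X \<in> Ob D) \<and>
     (\<forall>X \<in> Ob C. \<forall>Y \<in> Ob C. \<forall>f \<in> Hom C X Y. fmor F X Y f \<in> Hom D (fob F X) (fob F Y)) \<and>
     (\<forall>X \<in> Ob C. fmor F X X (Idt C X) = Idt D (fob F X)) \<and>
     (\<forall>X \<in> Ob C. \<forall>Y \<in> Ob C. \<forall>Z \<in> Ob C. \<forall>f \<in> Hom C X Y. \<forall>g \<in> Hom C Y Z.
        fmor F X Z (Cmp C X Y Z g f)
          = Cmp D (fob F X) (fob F Y) (fob F Z) (fmor F Y Z g) (fmor F X Y f))"

definition id_functor :: "('o, 'm, 'o, 'm) cfunctor" where
  "id_functor = \<lparr>fob = (\<lambda>X. X), fmor = (\<lambda>X Y f. f)\<rparr>"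

definition comp_functor ::
  "('p, 'n, 'q, 'k) cfunctor \<Rightarrow> ('o, 'm, 'p, 'n) cfunctor \<Rightarrow> ('o, 'm, 'q, 'k) cfunctor" where
  "comp_functor G F =
     \<lparr>fob = (\<lambda>X. fob G (fob F X)),
      fmor = (\<lambda>X Y f. fmor G (fob F X) (fob F Y) (fmor F X Y f))\<rparr>"

definition naturally_isomorphic ::
  "('o, 'm) cat \<Rightarrow> ('p, 'n) cat \<Rightarrow> ('o, 'm, 'p, 'n) cfunctor \<Rightarrow> ('o, 'm, 'p, 'n) cfunctor \<Rightarrow> bool"
  where
  "naturally_isomorphic C D F G \<longleftrightarrow>
     (\<exists>\<tau>. (\<forall>X \<in> Ob C. \<tau> X \<in> Iso D (fob F X) (fob G X)) \<and>
          (\<forall>X \<in> Ob C. \<forall>Y \<in> Ob C. \<forall>f \<in> Hom C X Y.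
             Cmp D (fob F X) (fob F Y) (fob G Y) (\<tau> Y) (fmor F X Y f)
               = Cmp D (fob F X) (fob G X) (fob G Y) (fmor G X Y f) (\<tau> X)))"

definition equivalent_categories :: "('o, 'm) cat \<Rightarrow> ('p, 'n) cat \<Rightarrow> bool" where
  "equivalent_categories C D \<longleftrightarrow>
     category C \<and> category D \<and>
     (\<exists>F G. is_functor C D F \<and> is_functor D C G \<and>
            naturally_isomorphic C C (comp_functor G F) id_functor \<and>
            naturally_isomorphic D D (comp_functor F G) id_functor)"

definition dually_equivalent :: "('o, 'm) cat \<Rightarrow> ('p, 'n) cat \<Rightarrow> bool" where
  "dually_equivalent C D \<longleftrightarrow> equivalent_categories C (opposite D)"


section \<open>Skeletal maps\<close>

definition skeletal_map :: "'a topology \<Rightarrow> 'b topology \<Rightarrow> ('a \<Rightarrow> 'b) \<Rightarrow> bool" where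
  "skeletal_map X Y f \<longleftrightarrow>
     f \<in> topspace X \<rightarrow> topspace Y \<and>
     (\<forall>V. openin Y V \<longrightarrow>
        X interior_of {x \<in> topspace X. f x \<in> Y closure_of V}
          \<subseteq> X closure_of {x \<in> topspace X. f x \<in> V})"


section \<open>Local contact algebras\<close>

text \<open>A Boolean algebra is rendered as a complemented distributive lattice with carrier,
  based on the lattices of HOL-Algebra; the one-element algebra is allowed.\<close>

locale boolean_lattice = bounded_lattice +
  assumes meet_join_distrib:
      "\<lbrakk>x \<in> carrier L; y \<in> carrier L; z \<in> carrier L\<rbrakk>
        \<Longrightarrow> x \<sqinter> (y \<squnion> z) = (x \<sqinter> y) \<squnion> (x \<sqinter> z)"
    and complement_exists:
      "x \<in> carrier L \<Longrightarrow> \<exists>y \<in> carrier L. x \<squnion> y = \<top> \<and> x \<sqinter> y = \<bottom>"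

definition complement :: "('a, 'more) gorder_scheme \<Rightarrow> 'a \<Rightarrow> 'a" where
  "complement L x =
     (THE y. y \<in> carrier L \<and> x \<squnion>\<^bsub>L\<^esub> y = \<top>\<^bsub>L\<^esub> \<and> x \<sqinter>\<^bsub>L\<^esub> y = \<bottom>\<^bsub>L\<^esub>)"

record 'a contact_lattice = "'a gorder" +
  contact :: "'a \<Rightarrow> 'a \<Rightarrow> bool"

record 'a local_contact_lattice = "'a contact_lattice" +
  bounded_elems :: "'a set"

definition well_inside :: "('a, 'more) contact_lattice_scheme \<Rightarrow> 'a \<Rightarrow> 'a \<Rightarrow> bool" where
  "well_inside L a b \<longleftrightarrow> \<not> contact L a (complement L b)"

locale contact_algebra = boolean_lattice L
  for L :: "('a, 'more) contact_lattice_scheme" (structure) +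
  assumes C1: "\<lbrakk>a \<in> carrier L; a \<noteq> \<bottom>\<rbrakk> \<Longrightarrow> contact L a a"
    and C2: "\<lbrakk>a \<in> carrier L; b \<in> carrier L; contact L a b\<rbrakk> \<Longrightarrow> a \<noteq> \<bottom> \<and> b \<noteq> \<bottom>"
    and C3: "\<lbrakk>a \<in> carrier L; b \<in> carrier L; contact L a b\<rbrakk> \<Longrightarrow> contact L b a"
    and C4: "\<lbrakk>a \<in> carrier L; b \<in> carrier L; c \<in> carrier L\<rbrakk>
              \<Longrightarrow> contact L a (b \<squnion> c) \<longleftrightarrow> contact L a b \<or> contact L a c"

definition lattice_ideal :: "('a, 'more) gorder_scheme \<Rightarrow> 'a set \<Rightarrow> bool" where
  "lattice_ideal L I \<longleftrightarrow>
     I \<subseteq> carrier L \<and> I \<noteq> {} \<and>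
     (\<forall>x \<in> I. \<forall>y \<in> carrier L. y \<sqsubseteq>\<^bsub>L\<^esub> x \<longrightarrow> y \<in> I) \<and>
     (\<forall>x \<in> I. \<forall>y \<in> I. x \<squnion>\<^bsub>L\<^esub> y \<in> I)"

locale local_contact_algebra = contact_algebra L
  for L :: "('a, 'more) local_contact_lattice_scheme" (structure) +
  assumes bounded_ideal: "lattice_ideal L (bounded_elems L)"
    and BC1: "\<lbrakk>a \<in> bounded_elems L; c \<in> carrier L; well_inside L a c\<rbrakk>
                \<Longrightarrow> \<exists>b \<in> bounded_elems L. well_inside L a b \<and> well_inside L b c"
    and BC2: "\<lbrakk>a \<in> carrier L; b \<in> carrier L; contact L a b\<rbrakk>
                \<Longrightarrow> \<exists>c \<in> bounded_elems L. contact L a (c \<sqinter> b)"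
    and BC3: "\<lbrakk>a \<in> carrier L; a \<noteq> \<bottom>\<rbrakk>
                \<Longrightarrow> \<exists>b \<in> bounded_elems L - {\<bottom>}. well_inside L b a"

locale complete_local_contact_algebra = local_contact_algebra L + complete_lattice L
  for L :: "('a, 'more) local_contact_lattice_scheme" (structure)

text \<open>Preservation of \<open>\<bottom>\<close>, \<open>\<top>\<close> and of binary joins and meets is the case of the empty set and
  of pairs in \<^const>\<open>sup_pres\<close> and \<^const>\<open>inf_pres\<close>.\<close>

definition complete_boolean_hom ::
  "('a, 'm) gorder_scheme \<Rightarrow> ('b, 'n) gorder_scheme \<Rightarrow> ('a \<Rightarrow> 'b) \<Rightarrow> bool" where
  "complete_boolean_hom A B \<phi> \<longleftrightarrow>
     \<phi> \<in> carrier A \<rightarrow> carrier B \<and> sup_pres A B \<phi> \<and> inf_pres A B \<phi> \<and>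
     (\<forall>a \<in> carrier A. \<phi> (complement A a) = complement B (\<phi> a))"

definition left_adjoint ::
  "('a, 'm) gorder_scheme \<Rightarrow> ('b, 'n) gorder_scheme \<Rightarrow> ('a \<Rightarrow> 'b) \<Rightarrow> 'b \<Rightarrow> 'a" where
  "left_adjoint A B \<phi> b =
     (THE c. c \<in> carrier A \<and> (\<forall>a \<in> carrier A. b \<sqsubseteq>\<^bsub>B\<^esub> \<phi> a \<longleftrightarrow> c \<sqsubseteq>\<^bsub>A\<^esub> a))"


section \<open>The two categories\<close>

text \<open>HOL has no type of all spaces or of all algebras, and no nontrivial type is provably closed
  under power sets, so the two (large) categories are given in stages indexed by an arbitrary
  cardinal \<open>r\<close>: the algebras with fewer than \<open>r\<close> elements, and the spaces with fewer than \<open>r\<close>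
  regular closed sets. The regular closed sets of a space are the elements of its dual algebra.
  For a strong limit cardinal \<open>r\<close> (such as the cardinality of a Grothendieck universe) these are
  just the spaces with fewer than \<open>r\<close> points and the algebras with fewer than \<open>r\<close> elements, see
  \<open>regular_closed_less_iff_topspace_less\<close> below. The algebras live on the type \<open>'u\<close> of \<open>r\<close>;
  the spaces live on \<open>'u set\<close>, which is large enough for every Hausdorff space with fewer than
  \<open>r\<close> regular closed sets, see \<open>SkeLC_exhaustive\<close>. As the type and the cardinal vary, every
  locally compact Hausdorff space and every complete local contact algebra is covered.

  Morphisms are functions that are \<^const>\<open>undefined\<close> outside of their domain, so that equal
  morphisms are equal functions.\<close>

definition regular_closed_sets :: "'a topology \<Rightarrow> 'a set set" where
  "regular_closed_sets X = {K. X closure_of (X interior_of K) = K}"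

definition SkeLC :: "'u rel \<Rightarrow> ('u set topology, 'u set \<Rightarrow> 'u set) cat" where
  "SkeLC r =
     \<lparr>Ob = {X. locally_compact_space X \<and> Hausdorff_space X \<and> |regular_closed_sets X| <o r},
      Hom = (\<lambda>X Y. {f \<in> extensional (topspace X). continuous_map X Y f \<and> skeletal_map X Y f}),
      Idt = (\<lambda>X. \<lambda>x \<in> topspace X. x),
      Cmp = (\<lambda>X Y Z g f. compose (topspace X) g f)\<rparr>"

definition DSkeLC :: "'u rel \<Rightarrow> ('u local_contact_lattice, 'u \<Rightarrow> 'u) cat" where
  "DSkeLC r =
     \<lparr>Ob = {A. complete_local_contact_algebra A \<and> |carrier A| <o r},
      Hom = (\<lambda>A B. {\<phi> \<in> extensional (carrier A).
               complete_boolean_hom A B \<phi> \<and>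
               (\<forall>a \<in> carrier A. \<forall>b \<in> carrier A. contact B (\<phi> a) (\<phi> b) \<longrightarrow> contact A a b) \<and>
               (\<forall>b \<in> bounded_elems B. left_adjoint A B \<phi> b \<in> bounded_elems A)}),
      Idt = (\<lambda>A. \<lambda>a \<in> carrier A. a),
      Cmp = (\<lambda>A B D \<psi> \<phi>. compose (carrier A) \<psi> \<phi>)\<rparr>"


section \<open>The size conditions\<close>

lemma regular_closed_sets_subset: "regular_closed_sets X \<subseteq> Pow (topspace X)"
proof
  fix K assume "K \<in> regular_closed_sets X"
  then have "K = X closure_of (X interior_of K)"
    by (simp add: regular_closed_sets_def)
  also have "\<dots> \<subseteq> topspace X"
    by (rule closure_of_subset_topspace)
  finally show "K \<in> Pow (topspace X)"
    by simp
qed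

lemma card_topspace_le_Pow_regular_closed:
  assumes "Hausdorff_space X"
  shows "|topspace X| \<le>o |Pow (regular_closed_sets X)|"
proof -
  define h where "h x = {K \<in> regular_closed_sets X. x \<in> K}" for x
  have "inj_on h (topspace X)"
  proof (rule inj_onI, rule ccontr)
    fix x y assume xy: "x \<in> topspace X" "y \<in> topspace X" "h x = h y" "x \<noteq> y"
    then obtain U V where UV: "openin X U" "openin X V" "x \<in> U" "y \<in> V" "disjnt U V"
      using assms unfolding Hausdorff_space_def by metis
    let ?K = "X closure_of U"
    have "X closure_of (X interior_of ?K) = ?K"
    proof
      show "X closure_of (X interior_of ?K) \<subseteq> ?K"
        by (simp add: closure_of_minimal interior_of_subset)
      show "?K \<subseteq> X closure_of (X interior_of ?K)"
        by (simp add: UV(1) closure_of_mono closure_of_subset interior_of_maximal openin_subset)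
    qed
    then have K: "?K \<in> regular_closed_sets X"
      by (simp add: regular_closed_sets_def)
    have "x \<in> ?K"
      using closure_of_subset[OF openin_subset[OF UV(1)]] UV(3) by (rule subsetD)
    moreover have "y \<notin> ?K"
    proof
      assume "y \<in> ?K"
      then obtain z where "z \<in> U" "z \<in> V"
        unfolding in_closure_of using UV(2,4) by blast
      with UV(5) show False
        by (auto simp: disjnt_iff)
    qed
    ultimately show False
      using K xy(3) unfolding h_def by blast
  qed
  moreover have "h ` topspace X \<subseteq> Pow (regular_closed_sets X)"
    by (auto simp: h_def)
  ultimately show ?thesis
    by (intro iffD1[OF card_of_ordLeq] exI[of _ h] conjI)
qed

lemma regular_closed_less_iff_topspace_less:
  fixes r :: "'u rel" and X :: "'a topology"
  assumes r: "Card_order r" and strong_limit: "\<And>A :: 'u set. |A| <o r \<Longrightarrow> |Pow A| <o r"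
    and "Hausdorff_space X"
  shows "|regular_closed_sets X| <o r \<longleftrightarrow> |topspace X| <o r"
proof -
  have Pow_less: "|Pow B| <o r" if "|B| <o r" for B :: "'b set"
  proof -
    have "|B| \<le>o |Field r|"
      using ordLess_imp_ordLeq[OF that] ordIso_symmetric[OF card_of_Field_ordIso[OF r]]
      by (rule ordLeq_ordIso_trans)
    then obtain g where g: "inj_on g B" "g ` B \<subseteq> Field r"
      unfolding card_of_ordLeq[symmetric] by blast
    have "|Pow (g ` B)| <o r"
      by (rule strong_limit, rule ordLeq_ordLess_trans[OF card_of_image that])
    moreover have "|Pow B| \<le>o |Pow (g ` B)|"
      by (rule ordIso_imp_ordLeq,
          rule card_of_ordIsoI[OF bij_betw_Pow[OF inj_on_imp_bij_betw[OF g(1)]]])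
    ultimately show ?thesis
      by (rule ordLeq_ordLess_trans[rotated])
  qed
  show ?thesis
  proof
    assume "|regular_closed_sets X| <o r"
    then show "|topspace X| <o r"
      by (rule ordLeq_ordLess_trans[OF card_topspace_le_Pow_regular_closed[OF assms(3)] Pow_less])
  next
    assume "|topspace X| <o r"
    then show "|regular_closed_sets X| <o r"
      by (rule ordLeq_ordLess_trans[OF card_of_mono1[OF regular_closed_sets_subset] Pow_less])
  qed
qed

lemma SkeLC_exhaustive:
  fixes r :: "'u rel" and X :: "'a topology"
  assumes r: "Card_order r" and X: "locally_compact_space X" "Hausdorff_space X"
    and less: "|regular_closed_sets X| <o r"
  shows "\<exists>Y \<in> Ob (SkeLC r). X homeomorphic_space Y"
proof -
  have "|regular_closed_sets X| \<le>o |Field r|"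
    using ordLess_imp_ordLeq[OF less] ordIso_symmetric[OF card_of_Field_ordIso[OF r]]
    by (rule ordLeq_ordIso_trans)
  then obtain h :: "'a set \<Rightarrow> 'u" where "inj_on h (regular_closed_sets X)"
    unfolding card_of_ordLeq[symmetric] by blast
  then have "inj_on ((`) h) (Pow (regular_closed_sets X))"
    by (simp add: inj_on_image_Pow)
  then have "|Pow (regular_closed_sets X)| \<le>o |UNIV :: 'u set set|"
    by (intro iffD1[OF card_of_ordLeq] exI[of _ "(`) h"]) simp
  with card_topspace_le_Pow_regular_closed[OF X(2)]
  have "|topspace X| \<le>o |UNIV :: 'u set set|"
    by (rule ordLeq_transitive)
  then obtain g :: "'a \<Rightarrow> 'u set" where g: "inj_on g (topspace X)"
    unfolding card_of_ordLeq[symmetric] by blast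
  define Y where "Y = pullback_topology (g ` topspace X) (inv_into (topspace X) g) X"
  have top: "topspace Y = g ` topspace X"
    unfolding Y_def topspace_pullback_topology by (auto simp: g)
  have "homeomorphic_maps X Y g (inv_into (topspace X) g)"
    unfolding homeomorphic_maps_def
  proof (intro conjI)
    have "continuous_map X X (inv_into (topspace X) g \<circ> g)"
      by (rule continuous_map_eq[OF continuous_map_id]) (simp add: g)
    then show "continuous_map X Y g"
      unfolding Y_def by (rule continuous_map_pullback') auto
    show "continuous_map Y X (inv_into (topspace X) g)"
      using continuous_map_pullback[OF continuous_map_id] unfolding Y_def by simp
    show "\<forall>x\<in>topspace X. inv_into (topspace X) g (g x) = x"
      using g by simp
    show "\<forall>y\<in>topspace Y. g (inv_into (topspace X) g y) = y"
      by (simp add: top f_inv_into_f)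
  qed
  then have hom: "homeomorphic_map X Y g"
    using homeomorphic_map_maps by blast
  then have XY: "X homeomorphic_space Y"
    using homeomorphic_map_imp_homeomorphic_space by blast
  have "regular_closed_sets Y \<subseteq> (`) g ` regular_closed_sets X"
  proof
    fix K assume K: "K \<in> regular_closed_sets Y"
    then have "K \<subseteq> g ` topspace X"
      using subsetD[OF regular_closed_sets_subset K] by (simp add: top)
    then obtain S where S: "S \<subseteq> topspace X" "K = g ` S"
      by (meson subset_imageE)
    have "g ` (X closure_of (X interior_of S)) = Y closure_of (Y interior_of (g ` S))"
      using homeomorphic_map_closure_of[OF hom interior_of_subset_topspace]
        homeomorphic_map_interior_of[OF hom S(1)] by simp
    also have "\<dots> = g ` S"
      using K unfolding regular_closed_sets_def S(2) by simp
    finally have "X closure_of (X interior_of S) = S"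
      using inj_on_image_eq_iff[OF g closure_of_subset_topspace S(1)] by simp
    then have "S \<in> regular_closed_sets X"
      by (simp add: regular_closed_sets_def)
    with S show "K \<in> (`) g ` regular_closed_sets X"
      by blast
  qed
  then have "|regular_closed_sets Y| <o r"
    using ordLeq_ordLess_trans[OF ordLeq_transitive[OF card_of_mono1 card_of_image] less] by blast
  then have "Y \<in> Ob (SkeLC r)"
    using X XY by (simp add: SkeLC_def homeomorphic_locally_compact_space homeomorphic_Hausdorff_space)
  with XY show ?thesis
    by blast
qed

end

theory Submission
  imports Defs
begin

text \<open>
  A space \<open>X\<close> is sent to the algebra of its regular closed sets, in which two sets are in contact if
  they intersect and a set is bounded if it is compact. A continuous skeletal map \<open>f : X \<rightarrow> Y\<close> is
  sent to the map that takes a regular closed set \<open>K\<close> of \<open>Y\<close> to the closure of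
  \<open>f\<^sup>-\<^sup>1(int K)\<close>. Skeletality says that this set does not change if \<open>int K\<close> is replaced by any
  open set with closure \<open>K\<close> (\<open>closure_preimage_closure\<close>), and this makes the map a complete
  homomorphism and the assignment a contravariant functor. It remains to see that the functor is
  faithful, full and essentially surjective, since a functor with these properties is an
  equivalence (\<open>fully_faithful_dense.equivalent\<close>).

  Faithful (\<open>dual_inject\<close>): two different values of \<open>f\<close> and \<open>g\<close> at a point are separated by a
  regular closed set, and its images under the two homomorphisms differ at this point.

  Full (\<open>dual_surjective\<close>): given a homomorphism \<open>\<phi>\<close>, the image of a point \<open>x\<close> must lie in every
  \<open>K\<close> for which \<open>\<phi> K\<close> is a neighbourhood of \<open>x\<close>. Condition L2 provides a compact one among these
  sets, so they have a common point, which is taken as the value at \<open>x\<close>. Condition L1 makes the map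
  so obtained continuous. As \<open>\<phi>\<close> preserves joins and
  complements, the map is skeletal and has \<open>\<phi>\<close> as its dual.

  Essentially surjective (\<open>representation\<close>): the points of a complete local contact algebra are
  its prime round filters, and an element \<open>a\<close> corresponds to the set of the filters that do not
  contain its complement. All that is needed about existence of points follows from one prime
  filter theorem (\<open>point_exists\<close>), an application of Zorn's lemma with a parameter \<open>S\<close> that stands
  for the property that the filter should keep. With ``meets \<open>a\<close> and \<open>b\<close> in parts in contact'' it
  yields a point common to \<open>a\<close> and \<open>b\<close>, and with ``\<open>a\<close> remains outside an ideal'' it yields the
  compactness of the sets of bounded elements.

  Algebras are not replaced by algebras of sets but come with an identification \<open>d\<close> of their elements
  with the regular closed sets of a space (\<open>regular_closed_representation\<close>). All results on duals
  are stated for arbitrary representations, so that the isomorphism between an algebra and that of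
  its space of points is just the dual of an identity map taken for two representations of the same
  space.
\<close>

section \<open>Fully faithful, essentially surjective functors\<close>

text \<open>An inverse of such a functor chooses a preimage of every object up to isomorphism;
  transporting a morphism along these isomorphisms and taking its unique preimage gives the
  morphism part.\<close>

locale fully_faithful_dense =
  C: category C + D: category D
  for C :: "('o, 'm) cat" and D :: "('p, 'n) cat" and F :: "('o, 'm, 'p, 'n) cfunctor" +
  assumes is_functor: "is_functor C D F"
    and faithful: "\<lbrakk>X \<in> Ob C; Y \<in> Ob C; f \<in> Hom C X Y; f' \<in> Hom C X Y;
        fmor F X Y f = fmor F X Y f'\<rbrakk> \<Longrightarrow> f = f'"
    and full: "\<lbrakk>X \<in> Ob C; Y \<in> Ob C; g \<in> Hom D (fob F X) (fob F Y)\<rbrakk>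
        \<Longrightarrow> \<exists>f \<in> Hom C X Y. fmor F X Y f = g"
    and dense: "A \<in> Ob D \<Longrightarrow> \<exists>X \<in> Ob C. Iso D (fob F X) A \<noteq> {}"
begin

lemma F_Ob: "X \<in> Ob C \<Longrightarrow> fob F X \<in> Ob D"
  and F_Hom: "\<lbrakk>X \<in> Ob C; Y \<in> Ob C; f \<in> Hom C X Y\<rbrakk> \<Longrightarrow> fmor F X Y f \<in> Hom D (fob F X) (fob F Y)"
  and F_Idt: "X \<in> Ob C \<Longrightarrow> fmor F X X (Idt C X) = Idt D (fob F X)"
  and F_Cmp: "\<lbrakk>X \<in> Ob C; Y \<in> Ob C; Z \<in> Ob C; f \<in> Hom C X Y; g \<in> Hom C Y Z\<rbrakk>
    \<Longrightarrow> fmor F X Z (Cmp C X Y Z g f)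
        = Cmp D (fob F X) (fob F Y) (fob F Z) (fmor F Y Z g) (fmor F X Y f)"
  using is_functor unfolding is_functor_def by auto

definition lift :: "'o \<Rightarrow> 'o \<Rightarrow> 'n \<Rightarrow> 'm" where
  "lift X Y g = (SOME f. f \<in> Hom C X Y \<and> fmor F X Y f = g)"

lemma
  assumes "X \<in> Ob C" "Y \<in> Ob C" "g \<in> Hom D (fob F X) (fob F Y)"
  shows lift_Hom: "lift X Y g \<in> Hom C X Y" and F_lift: "fmor F X Y (lift X Y g) = g"
  using someI_ex[of "\<lambda>f. f \<in> Hom C X Y \<and> fmor F X Y f = g"] full[OF assms]
  unfolding lift_def by blast+

lemma lift_eqI:
  "\<lbrakk>X \<in> Ob C; Y \<in> Ob C; f \<in> Hom C X Y; fmor F X Y f = g\<rbrakk> \<Longrightarrow> lift X Y g = f"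
  using faithful lift_Hom F_lift F_Hom by metis

lemma lift_Cmp:
  assumes "X \<in> Ob C" "Y \<in> Ob C" "Z \<in> Ob C"
    "f \<in> Hom D (fob F X) (fob F Y)" "g \<in> Hom D (fob F Y) (fob F Z)"
  shows "lift X Z (Cmp D (fob F X) (fob F Y) (fob F Z) g f)
    = Cmp C X Y Z (lift Y Z g) (lift X Y f)"
  using assms by (intro lift_eqI C.comp_in_Hom) (simp_all add: lift_Hom F_Cmp F_lift)

lemma lift_Iso:
  assumes X: "X \<in> Ob C" "Y \<in> Ob C" and g: "g \<in> Iso D (fob F X) (fob F Y)"
  shows "lift X Y g \<in> Iso C X Y"
proof -
  obtain h where gh: "g \<in> Hom D (fob F X) (fob F Y)" "h \<in> Hom D (fob F Y) (fob F X)"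
    "Cmp D (fob F X) (fob F Y) (fob F X) h g = Idt D (fob F X)"
    "Cmp D (fob F Y) (fob F X) (fob F Y) g h = Idt D (fob F Y)"
    using g unfolding Iso_def by blast
  have "lift X X (Idt D (fob F X)) = Idt C X" "lift Y Y (Idt D (fob F Y)) = Idt C Y"
    using X by (intro lift_eqI C.id_in_Hom F_Idt; simp)+
  then show ?thesis
    unfolding Iso_def using lift_Hom[OF X gh(1)] lift_Hom[OF X(2,1) gh(2)] gh
      lift_Cmp[OF X X(1) gh(1,2)] lift_Cmp[OF X(2,1) X(2) gh(2,1)] by auto
qed

definition G0 :: "'p \<Rightarrow> 'o" where
  "G0 A = (SOME X. X \<in> Ob C \<and> Iso D (fob F X) A \<noteq> {})"

definition counit :: "'p \<Rightarrow> 'n" where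
  "counit A = (SOME s. s \<in> Iso D (fob F (G0 A)) A)"

definition counit_inv :: "'p \<Rightarrow> 'n" where
  "counit_inv A = (SOME t. t \<in> Hom D A (fob F (G0 A)) \<and>
     Cmp D (fob F (G0 A)) A (fob F (G0 A)) t (counit A) = Idt D (fob F (G0 A)) \<and>
     Cmp D A (fob F (G0 A)) A (counit A) t = Idt D A)"

lemma assumes "A \<in> Ob D"
  shows G0_Ob: "G0 A \<in> Ob C" and counit_Iso: "counit A \<in> Iso D (fob F (G0 A)) A"
    and FG0_Ob: "fob F (G0 A) \<in> Ob D"
proof -
  have *: "G0 A \<in> Ob C \<and> Iso D (fob F (G0 A)) A \<noteq> {}"
    unfolding G0_def by (rule someI_ex) (use dense assms in blast)
  then show "G0 A \<in> Ob C" by simp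
  then show "fob F (G0 A) \<in> Ob D" by (rule F_Ob)
  from * show "counit A \<in> Iso D (fob F (G0 A)) A"
    unfolding counit_def using someI_ex[of "\<lambda>s. s \<in> Iso D (fob F (G0 A)) A"] by blast
qed

lemma assumes "A \<in> Ob D"
  shows counit_Hom: "counit A \<in> Hom D (fob F (G0 A)) A"
    and counit_inv_Hom: "counit_inv A \<in> Hom D A (fob F (G0 A))"
    and counit_inv_counit:
      "Cmp D (fob F (G0 A)) A (fob F (G0 A)) (counit_inv A) (counit A) = Idt D (fob F (G0 A))"
    and counit_counit_inv: "Cmp D A (fob F (G0 A)) A (counit A) (counit_inv A) = Idt D A"
proof -
  show "counit A \<in> Hom D (fob F (G0 A)) A"
    using counit_Iso[OF assms] by (simp add: Iso_def)
  have "\<exists>t. t \<in> Hom D A (fob F (G0 A)) \<and>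
     Cmp D (fob F (G0 A)) A (fob F (G0 A)) t (counit A) = Idt D (fob F (G0 A)) \<and>
     Cmp D A (fob F (G0 A)) A (counit A) t = Idt D A"
    using counit_Iso[OF assms] unfolding Iso_def by blast
  from someI_ex[OF this]
  show "counit_inv A \<in> Hom D A (fob F (G0 A))"
    "Cmp D (fob F (G0 A)) A (fob F (G0 A)) (counit_inv A) (counit A) = Idt D (fob F (G0 A))"
    "Cmp D A (fob F (G0 A)) A (counit A) (counit_inv A) = Idt D A"
    unfolding counit_inv_def by blast+
qed

definition transport :: "'p \<Rightarrow> 'p \<Rightarrow> 'n \<Rightarrow> 'n" where
  "transport A B g = Cmp D (fob F (G0 A)) B (fob F (G0 B)) (counit_inv B)
                  (Cmp D (fob F (G0 A)) A B g (counit A))"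

lemma transport_Hom:
  "\<lbrakk>A \<in> Ob D; B \<in> Ob D; g \<in> Hom D A B\<rbrakk> \<Longrightarrow> transport A B g \<in> Hom D (fob F (G0 A)) (fob F (G0 B))"
  unfolding transport_def by (intro D.comp_in_Hom FG0_Ob counit_Hom counit_inv_Hom)

lemma counit_transport:
  assumes "A \<in> Ob D" "B \<in> Ob D" "g \<in> Hom D A B"
  shows "Cmp D (fob F (G0 A)) (fob F (G0 B)) B (counit B) (transport A B g)
    = Cmp D (fob F (G0 A)) A B g (counit A)"
proof -
  have 1: "Cmp D (fob F (G0 A)) A B g (counit A) \<in> Hom D (fob F (G0 A)) B"
    using assms by (intro D.comp_in_Hom FG0_Ob counit_Hom)
  show ?thesis
    unfolding transport_def
    using D.comp_assoc[OF FG0_Ob[OF assms(1)] assms(2) FG0_Ob[OF assms(2)] assms(2) 1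
        counit_inv_Hom[OF assms(2)] counit_Hom[OF assms(2)], symmetric]
      D.comp_id_left[OF FG0_Ob[OF assms(1)] assms(2) 1] counit_counit_inv[OF assms(2)] by simp
qed

lemma counit_cancel:
  assumes "B \<in> Ob D" "P \<in> Ob D" "h \<in> Hom D P (fob F (G0 B))" "h' \<in> Hom D P (fob F (G0 B))"
    and "Cmp D P (fob F (G0 B)) B (counit B) h = Cmp D P (fob F (G0 B)) B (counit B) h'"
  shows "h = h'"
proof -
  have "Cmp D P B (fob F (G0 B)) (counit_inv B) (Cmp D P (fob F (G0 B)) B (counit B) h) = h"
    if "h \<in> Hom D P (fob F (G0 B))" for h
    using D.comp_assoc[OF assms(2) FG0_Ob[OF assms(1)] assms(1) FG0_Ob[OF assms(1)] that
        counit_Hom[OF assms(1)] counit_inv_Hom[OF assms(1)], symmetric]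
      counit_inv_counit[OF assms(1)] D.comp_id_left[OF assms(2) FG0_Ob[OF assms(1)] that] by simp
  then show ?thesis using assms(3-5) by metis
qed

definition G :: "('p, 'n, 'o, 'm) cfunctor" where
  "G = \<lparr>fob = G0, fmor = (\<lambda>A B g. lift (G0 A) (G0 B) (transport A B g))\<rparr>"

lemma G_functor: "is_functor D C G"
proof -
  have id: "transport A A (Idt D A) = Idt D (fob F (G0 A))" if A: "A \<in> Ob D" for A
    unfolding transport_def
    by (simp add: D.comp_id_left[OF FG0_Ob[OF A] A counit_Hom[OF A]] counit_inv_counit[OF A])
  have id': "lift (G0 A) (G0 A) (Idt D (fob F (G0 A))) = Idt C (G0 A)" if A: "A \<in> Ob D" for A
    using that by (intro lift_eqI C.id_in_Hom F_Idt G0_Ob)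
  have cmp: "transport A B' (Cmp D A B B' h g)
      = Cmp D (fob F (G0 A)) (fob F (G0 B)) (fob F (G0 B')) (transport B B' h) (transport A B g)"
    if A: "A \<in> Ob D" "B \<in> Ob D" "B' \<in> Ob D" and g: "g \<in> Hom D A B" and h: "h \<in> Hom D B B'"
    for A B B' g h
  proof (rule counit_cancel[OF A(3) FG0_Ob[OF A(1)]])
    let ?A = "fob F (G0 A)" and ?B = "fob F (G0 B)" and ?B' = "fob F (G0 B')"
    note O = FG0_Ob[OF A(1)] FG0_Ob[OF A(2)] FG0_Ob[OF A(3)]
    note cg = transport_Hom[OF A(1,2) g] and ch = transport_Hom[OF A(2,3) h]
    have hg: "Cmp D A B B' h g \<in> Hom D A B'"
      by (rule D.comp_in_Hom[OF A g h])
    show "transport A B' (Cmp D A B B' h g) \<in> Hom D ?A ?B'"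
      by (rule transport_Hom[OF A(1,3) hg])
    show "Cmp D ?A ?B ?B' (transport B B' h) (transport A B g) \<in> Hom D ?A ?B'"
      by (rule D.comp_in_Hom[OF O cg ch])
    have "Cmp D ?A ?B' B' (counit B') (Cmp D ?A ?B ?B' (transport B B' h) (transport A B g))
        = Cmp D ?A ?B B' (Cmp D ?B ?B' B' (counit B') (transport B B' h)) (transport A B g)"
      by (rule D.comp_assoc[OF O A(3) cg ch counit_Hom[OF A(3)], symmetric])
    also have "\<dots> = Cmp D ?A ?B B' (Cmp D ?B B B' h (counit B)) (transport A B g)"
      by (simp add: counit_transport[OF A(2,3) h])
    also have "\<dots> = Cmp D ?A B B' h (Cmp D ?A ?B B (counit B) (transport A B g))"
      by (rule D.comp_assoc[OF O(1,2) A(2,3) cg counit_Hom[OF A(2)] h])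
    also have "\<dots> = Cmp D ?A B B' h (Cmp D ?A A B g (counit A))"
      by (simp add: counit_transport[OF A(1,2) g])
    also have "\<dots> = Cmp D ?A A B' (Cmp D A B B' h g) (counit A)"
      by (rule D.comp_assoc[OF O(1) A counit_Hom[OF A(1)] g h, symmetric])
    also have "\<dots> = Cmp D ?A ?B' B' (counit B') (transport A B' (Cmp D A B B' h g))"
      by (simp add: counit_transport[OF A(1,3) hg])
    finally show "Cmp D ?A ?B' B' (counit B') (transport A B' (Cmp D A B B' h g))
      = Cmp D ?A ?B' B' (counit B') (Cmp D ?A ?B ?B' (transport B B' h) (transport A B g))" ..
  qed
  show ?thesis
    unfolding is_functor_def G_def cfunctor.simps
    using G0_Ob transport_Hom lift_Hom lift_Cmp id id' cmp by simp
qed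

lemma FG_natural: "naturally_isomorphic D D (comp_functor F G) id_functor"
  unfolding naturally_isomorphic_def comp_functor_def id_functor_def G_def cfunctor.simps
  by (rule exI[of _ counit]) (simp add: counit_Iso F_lift G0_Ob transport_Hom counit_transport)

lemma GF_natural: "naturally_isomorphic C C (comp_functor G F) id_functor"
  unfolding naturally_isomorphic_def comp_functor_def id_functor_def G_def cfunctor.simps
proof (intro exI[of _ "\<lambda>X. lift (G0 (fob F X)) X (counit (fob F X))"] conjI ballI)
  fix X assume X: "X \<in> Ob C"
  then show "lift (G0 (fob F X)) X (counit (fob F X)) \<in> Iso C (G0 (fob F X)) X"
    using X by (intro lift_Iso G0_Ob F_Ob counit_Iso)
next
  fix X Y f assume X: "X \<in> Ob C" "Y \<in> Ob C" and f: "f \<in> Hom C X Y"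
  let ?FX = "fob F X" and ?FY = "fob F Y"
  note FX = F_Ob[OF X(1)] and FY = F_Ob[OF X(2)] and Ff = F_Hom[OF X f]
  have lf: "lift X Y (fmor F X Y f) = f"
    using X f by (intro lift_eqI) auto
  have "Cmp C (G0 ?FX) (G0 ?FY) Y (lift (G0 ?FY) Y (counit ?FY))
          (lift (G0 ?FX) (G0 ?FY) (transport ?FX ?FY (fmor F X Y f)))
      = lift (G0 ?FX) Y (Cmp D (fob F (G0 ?FX)) (fob F (G0 ?FY)) ?FY (counit ?FY)
          (transport ?FX ?FY (fmor F X Y f)))"
    by (intro lift_Cmp[symmetric] G0_Ob FX FY X counit_Hom transport_Hom Ff)
  also have "\<dots> = lift (G0 ?FX) Y (Cmp D (fob F (G0 ?FX)) ?FX ?FY (fmor F X Y f) (counit ?FX))"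
    by (simp add: counit_transport[OF FX FY Ff])
  also have "\<dots> = Cmp C (G0 ?FX) X Y f (lift (G0 ?FX) X (counit ?FX))"
    using lift_Cmp[OF G0_Ob[OF FX] X counit_Hom[OF FX] Ff] lf by simp
  finally show "Cmp C (G0 ?FX) (G0 ?FY) Y (lift (G0 ?FY) Y (counit ?FY))
          (lift (G0 ?FX) (G0 ?FY) (transport ?FX ?FY (fmor F X Y f)))
      = Cmp C (G0 ?FX) X Y f (lift (G0 ?FX) X (counit ?FX))" .
qed

theorem equivalent: "equivalent_categories C D"
  unfolding equivalent_categories_def
  using C.category_axioms D.category_axioms is_functor G_functor FG_natural GF_natural by blast

end

section \<open>Calculus in Boolean and contact algebras\<close>

notation complement (\<open>\<sim>\<index> _\<close> [81] 80)
notation contact (infix \<open>\<bowtie>\<index>\<close> 50)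
notation well_inside (infix \<open>\<lless>\<index>\<close> 50)

context boolean_lattice
begin

lemma le_meet_iff [simp]:
  "\<lbrakk>x \<in> carrier L; y \<in> carrier L; z \<in> carrier L\<rbrakk> \<Longrightarrow> z \<sqsubseteq> x \<sqinter> y \<longleftrightarrow> z \<sqsubseteq> x \<and> z \<sqsubseteq> y"
  by (meson le_trans meet_closed meet_le meet_left meet_right)

lemma join_le_iff [simp]:
  "\<lbrakk>x \<in> carrier L; y \<in> carrier L; z \<in> carrier L\<rbrakk> \<Longrightarrow> x \<squnion> y \<sqsubseteq> z \<longleftrightarrow> x \<sqsubseteq> z \<and> y \<sqsubseteq> z"
  by (meson le_trans join_closed join_le join_left join_right)

lemma meet_mono:
  assumes "x \<sqsubseteq> x'" "y \<sqsubseteq> y'"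
    and "x \<in> carrier L" "y \<in> carrier L" "x' \<in> carrier L" "y' \<in> carrier L"
  shows "x \<sqinter> y \<sqsubseteq> x' \<sqinter> y'"
  using assms le_trans[OF meet_left, of x y x'] le_trans[OF meet_right, of x y y'] by simp

lemma le_bottom_iff: "x \<in> carrier L \<Longrightarrow> x \<sqsubseteq> \<bottom> \<longleftrightarrow> x = \<bottom>"
  using le_antisym[of x \<bottom>] by auto

lemma meet_idem [simp]: "x \<in> carrier L \<Longrightarrow> x \<sqinter> x = x"
  using le_iff_join le_refl by metis

lemma top_meet' [simp]: "x \<in> carrier L \<Longrightarrow> \<top> \<sqinter> x = x"
  and bottom_join' [simp]: "x \<in> carrier L \<Longrightarrow> \<bottom> \<squnion> x = x"
  and bottom_meet' [simp]: "x \<in> carrier L \<Longrightarrow> \<bottom> \<sqinter> x = \<bottom>"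
  using bottom_join[of x] top_meet[of x] bottom_meet[of x] by (simp_all only: eq_is_equal)

lemma meet_top [simp]: "x \<in> carrier L \<Longrightarrow> x \<sqinter> \<top> = x"
  and join_bottom [simp]: "x \<in> carrier L \<Longrightarrow> x \<squnion> \<bottom> = x"
  using top_meet' bottom_join' by (simp_all only: meet_comm[of L x \<top>] join_comm[of L x \<bottom>])

lemma complement_unique:
  assumes "x \<in> carrier L" "y \<in> carrier L" "z \<in> carrier L"
    "x \<squnion> y = \<top>" "x \<sqinter> y = \<bottom>" "x \<squnion> z = \<top>" "x \<sqinter> z = \<bottom>"
  shows "y = z"
proof -
  have "u \<sqsubseteq> v" if "u \<in> carrier L" "v \<in> carrier L" "x \<sqinter> u = \<bottom>" "x \<squnion> v = \<top>" for u v
  proof -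
    have "u = u \<sqinter> (x \<squnion> v)"
      using that by simp
    also have "\<dots> = \<bottom> \<squnion> (u \<sqinter> v)"
      using meet_join_distrib[of u x v] that(1-3) assms(1) by (simp add: meet_comm[of L u x])
    also have "\<dots> \<sqsubseteq> v"
      using that by (simp add: meet_right)
    finally show ?thesis .
  qed
  then show ?thesis using assms le_antisym by blast
qed

lemma complement:
  assumes "x \<in> carrier L"
  shows "\<sim>x \<in> carrier L \<and> x \<squnion> \<sim>x = \<top> \<and> x \<sqinter> \<sim>x = \<bottom>"
proof -
  obtain y where y: "y \<in> carrier L \<and> x \<squnion> y = \<top> \<and> x \<sqinter> y = \<bottom>"
    using complement_exists[OF assms] by blast
  then show ?thesis
    unfolding complement_def
    by (rule theI[where a = y]) (use complement_unique assms y in blast)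
qed

lemma complement_closed [simp, intro]: "x \<in> carrier L \<Longrightarrow> \<sim>x \<in> carrier L"
  and join_complement [simp]: "x \<in> carrier L \<Longrightarrow> x \<squnion> \<sim>x = \<top>"
  and meet_complement [simp]: "x \<in> carrier L \<Longrightarrow> x \<sqinter> \<sim>x = \<bottom>"
  using complement by blast+

lemma complement_eqI:
  "\<lbrakk>x \<in> carrier L; y \<in> carrier L; x \<squnion> y = \<top>; x \<sqinter> y = \<bottom>\<rbrakk> \<Longrightarrow> \<sim>x = y"
  using complement complement_unique by blast

lemma complement_complement [simp]: "x \<in> carrier L \<Longrightarrow> \<sim>(\<sim>x) = x"
  by (rule complement_eqI) (simp_all add: meet_comm[of L _ x] join_comm[of L _ x])

lemma meet_split: "\<lbrakk>x \<in> carrier L; y \<in> carrier L\<rbrakk> \<Longrightarrow> x = (x \<sqinter> y) \<squnion> (x \<sqinter> \<sim>y)"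
  using meet_join_distrib[of x y "\<sim>y"] by simp

lemma meet_eq_bottom_iff:
  assumes "x \<in> carrier L" "y \<in> carrier L"
  shows "x \<sqinter> y = \<bottom> \<longleftrightarrow> x \<sqsubseteq> \<sim>y"
proof
  assume "x \<sqinter> y = \<bottom>"
  then have "x = \<bottom> \<squnion> (x \<sqinter> \<sim>y)" using meet_split assms by metis
  also have "\<dots> \<sqsubseteq> \<sim>y" using assms by (simp add: meet_right)
  finally show "x \<sqsubseteq> \<sim>y" .
next
  assume "x \<sqsubseteq> \<sim>y"
  then have "x \<sqinter> y \<sqsubseteq> y \<sqinter> \<sim>y"
    using assms le_trans[OF meet_left, of x y "\<sim>y"] by (simp add: meet_right del: meet_complement)
  then show "x \<sqinter> y = \<bottom>" using assms by (simp add: le_bottom_iff)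
qed

lemma complement_le_iff [simp]:
  "\<lbrakk>x \<in> carrier L; y \<in> carrier L\<rbrakk> \<Longrightarrow> \<sim>x \<sqsubseteq> \<sim>y \<longleftrightarrow> y \<sqsubseteq> x"
  using meet_eq_bottom_iff[of "\<sim>x" y] meet_eq_bottom_iff[of y "\<sim>x"]
  by (simp add: meet_comm[of L y "\<sim>x"])

lemma complement_bottom [simp]: "\<sim>\<bottom> = \<top>"
  by (rule complement_eqI) simp_all

lemma complement_top [simp]: "\<sim>\<top> = \<bottom>"
  using complement_complement[of \<bottom>] by simp

lemma complement_meet:
  assumes "x \<in> carrier L" "y \<in> carrier L"
  shows "\<sim>(x \<sqinter> y) = \<sim>x \<squnion> \<sim>y"
proof (rule le_antisym)
  have "\<sim>(\<sim>x \<squnion> \<sim>y) \<sqsubseteq> x \<sqinter> y"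
    using assms complement_le_iff[of "\<sim>x \<squnion> \<sim>y" "\<sim>x"] complement_le_iff[of "\<sim>x \<squnion> \<sim>y" "\<sim>y"]
    by (simp add: join_left join_right)
  then show "\<sim>(x \<sqinter> y) \<sqsubseteq> \<sim>x \<squnion> \<sim>y"
    using assms complement_le_iff[of "x \<sqinter> y" "\<sim>(\<sim>x \<squnion> \<sim>y)"] by simp
qed (use assms in \<open>simp_all add: meet_left meet_right\<close>)

end

context contact_algebra
begin

lemma contact_mono:
  assumes "a \<bowtie> b" "a \<sqsubseteq> a'" "b \<sqsubseteq> b'"
    "a \<in> carrier L" "b \<in> carrier L" "a' \<in> carrier L" "b' \<in> carrier L"
  shows "a' \<bowtie> b'"
proof -
  have *: "x \<bowtie> z" if "x \<bowtie> y" "y \<sqsubseteq> z" "x \<in> carrier L" "y \<in> carrier L" "z \<in> carrier L" for x y z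
    using C4[of x y z] that le_iff_meet[of y z] by simp
  have "a \<bowtie> b'" using *[OF assms(1,3)] assms by blast
  then have "b' \<bowtie> a'" using *[of b' a a'] C3 assms by blast
  then show ?thesis using C3 assms by blast
qed

lemma contact_split_right:
  "\<lbrakk>a \<bowtie> b; a \<in> carrier L; b \<in> carrier L; c \<in> carrier L\<rbrakk> \<Longrightarrow> a \<bowtie> b \<sqinter> c \<or> a \<bowtie> b \<sqinter> \<sim>c"
  using C4[of a "b \<sqinter> c" "b \<sqinter> \<sim>c"] meet_split[of b c] by auto

lemma contact_split_left:
  "\<lbrakk>a \<bowtie> b; a \<in> carrier L; b \<in> carrier L; c \<in> carrier L\<rbrakk> \<Longrightarrow> a \<sqinter> c \<bowtie> b \<or> a \<sqinter> \<sim>c \<bowtie> b"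
  using contact_split_right[of b a c] C3 by (meson complement_closed meet_closed)

lemma contact_cut:
  assumes "a \<bowtie> b" "a \<in> carrier L" "b \<in> carrier L" "c \<in> carrier L"
  obtains a' where "a' \<in> carrier L" "a' \<bowtie> b" "a' \<sqsubseteq> a" "a' \<sqsubseteq> c \<or> a' \<sqsubseteq> \<sim>c"
proof -
  have *: "x \<sqinter> y \<sqsubseteq> x" "x \<sqinter> y \<sqsubseteq> y" if "x \<in> carrier L" "y \<in> carrier L" for x y
    using that by (simp_all add: meet_left meet_right)
  show thesis
    using contact_split_left[OF assms] that[of "a \<sqinter> c"] that[of "a \<sqinter> \<sim>c"] * assms(2-4) by auto
qed

lemma well_inside_le:
  assumes "a \<lless> b" "a \<in> carrier L" "b \<in> carrier L"
  shows "a \<sqsubseteq> b"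
proof (rule ccontr)
  assume "\<not> a \<sqsubseteq> b"
  then have "a \<sqinter> \<sim>b \<noteq> \<bottom>"
    using assms meet_eq_bottom_iff[of a "\<sim>b"] by simp
  then have "a \<sqinter> \<sim>b \<bowtie> a \<sqinter> \<sim>b" using assms C1 by simp
  then have "a \<bowtie> \<sim>b"
    by (rule contact_mono) (use assms in \<open>simp_all add: meet_left meet_right\<close>)
  with assms show False unfolding well_inside_def by simp
qed

lemma well_inside_mono:
  "\<lbrakk>a \<lless> b; a' \<sqsubseteq> a; b \<sqsubseteq> b'; a \<in> carrier L; b \<in> carrier L; a' \<in> carrier L; b' \<in> carrier L\<rbrakk>
    \<Longrightarrow> a' \<lless> b'"
  unfolding well_inside_def using contact_mono[of a' "\<sim>b'" a "\<sim>b"] by auto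

lemma well_inside_meet:
  assumes "a \<lless> b" "a' \<lless> b'" "a \<in> carrier L" "b \<in> carrier L" "a' \<in> carrier L" "b' \<in> carrier L"
  shows "a \<sqinter> a' \<lless> b \<sqinter> b'"
proof -
  have "a \<sqinter> a' \<lless> b" "a \<sqinter> a' \<lless> b'"
    using assms well_inside_mono[of a b "a \<sqinter> a'" b] well_inside_mono[of a' b' "a \<sqinter> a'" b']
    by (simp_all add: meet_left meet_right)
  then show ?thesis
    using assms unfolding well_inside_def by (simp add: complement_meet C4)
qed

lemma well_inside_complement:
  "\<lbrakk>a \<lless> b; a \<in> carrier L; b \<in> carrier L\<rbrakk> \<Longrightarrow> \<sim>b \<lless> \<sim>a"
  unfolding well_inside_def using C3 by auto

lemma well_inside_top: "a \<in> carrier L \<Longrightarrow> a \<lless> \<top>"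
  unfolding well_inside_def using C2[of a \<bottom>] by auto

end

section \<open>Prime round filters in local contact algebras\<close>

text \<open>A point is a proper round filter with a bounded element that is prime with respect to
  \<open>\<lless>\<close>. In the algebra of regular closed sets of a locally compact Hausdorff space, these are
  the filters of neighbourhoods of the points of the space. For an ultrafilter, \<open>c\<close> and \<open>e\<close> would
  coincide; the gap between them is the price of roundness.\<close>

context local_contact_algebra
begin

definition round_filter :: "'a set \<Rightarrow> bool" where
  "round_filter p \<longleftrightarrow> p \<subseteq> carrier L \<and> p \<inter> bounded_elems L \<noteq> {} \<and>
     (\<forall>x \<in> p. \<forall>y \<in> p. x \<sqinter> y \<in> p) \<and> (\<forall>x \<in> p. \<forall>y \<in> carrier L. x \<sqsubseteq> y \<longrightarrow> y \<in> p) \<and>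
     (\<forall>x \<in> p. \<exists>y \<in> p. y \<lless> x)"

definition point :: "'a set \<Rightarrow> bool" where
  "point p \<longleftrightarrow> round_filter p \<and> \<bottom> \<notin> p \<and>
     (\<forall>c \<in> bounded_elems L. \<forall>e \<in> carrier L. c \<lless> e \<longrightarrow> \<sim>c \<in> p \<or> e \<in> p)"

lemma bounded_closed [simp, intro]: "b \<in> bounded_elems L \<Longrightarrow> b \<in> carrier L"
  and bounded_down: "\<lbrakk>b \<in> bounded_elems L; a \<in> carrier L; a \<sqsubseteq> b\<rbrakk> \<Longrightarrow> a \<in> bounded_elems L"
  and bounded_join: "\<lbrakk>b \<in> bounded_elems L; a \<in> bounded_elems L\<rbrakk> \<Longrightarrow> a \<squnion> b \<in> bounded_elems L"
  and bounded_bottom: "\<bottom> \<in> bounded_elems L"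
  using bounded_ideal unfolding lattice_ideal_def by (auto intro: bottom_lower)

lemma round_filterD:
  assumes "round_filter p"
  shows "x \<in> p \<Longrightarrow> x \<in> carrier L" "\<lbrakk>x \<in> p; y \<in> p\<rbrakk> \<Longrightarrow> x \<sqinter> y \<in> p"
    "\<lbrakk>x \<in> p; x \<sqsubseteq> y; y \<in> carrier L\<rbrakk> \<Longrightarrow> y \<in> p" "\<exists>z. z \<in> p \<and> z \<in> bounded_elems L"
    "x \<in> p \<Longrightarrow> \<exists>y \<in> p. y \<lless> x" "\<top> \<in> p"
proof -
  show "x \<in> p \<Longrightarrow> x \<in> carrier L" "\<lbrakk>x \<in> p; y \<in> p\<rbrakk> \<Longrightarrow> x \<sqinter> y \<in> p"
    "\<lbrakk>x \<in> p; x \<sqsubseteq> y; y \<in> carrier L\<rbrakk> \<Longrightarrow> y \<in> p" "\<exists>z. z \<in> p \<and> z \<in> bounded_elems L"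
    "x \<in> p \<Longrightarrow> \<exists>y \<in> p. y \<lless> x"
    using assms unfolding round_filter_def by blast+
  then show "\<top> \<in> p"
    using assms unfolding round_filter_def by (metis bounded_closed top_closed top_higher)
qed

text \<open>Adding to \<open>p\<close> everything that contains \<open>c\<close> well inside keeps it round,
  as \<open>\<lless>\<close> interpolates above bounded elements.\<close>

definition adjoin :: "'a set \<Rightarrow> 'a \<Rightarrow> 'a set" where
  "adjoin p c = {t \<in> carrier L. \<exists>x \<in> p. \<exists>y \<in> carrier L. c \<lless> y \<and> x \<sqinter> y \<sqsubseteq> t}"

lemma meet_bounded: "\<lbrakk>b \<in> bounded_elems L; a \<in> carrier L\<rbrakk> \<Longrightarrow> a \<sqinter> b \<in> bounded_elems L"
  "\<lbrakk>b \<in> bounded_elems L; a \<in> carrier L\<rbrakk> \<Longrightarrow> b \<sqinter> a \<in> bounded_elems L"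
  by (rule bounded_down[of b]; simp add: meet_left meet_right)+

lemma adjoinI:
  "\<lbrakk>x \<in> p; y \<in> carrier L; c \<lless> y; x \<sqinter> y \<sqsubseteq> t; t \<in> carrier L\<rbrakk> \<Longrightarrow> t \<in> adjoin p c"
  unfolding adjoin_def by blast

lemma adjoin_superset:
  assumes p: "round_filter p" and c: "c \<in> carrier L"
  shows "p \<subseteq> adjoin p c"
proof
  fix t assume t: "t \<in> p"
  then have "t \<in> carrier L" by (rule round_filterD(1)[OF p])
  then show "t \<in> adjoin p c"
    using adjoinI[OF t top_closed well_inside_top[OF c]] by simp
qed

lemma adjoin_round:
  assumes p: "round_filter p" and c: "c \<in> bounded_elems L"
  shows "round_filter (adjoin p c)"
  unfolding round_filter_def
proof (intro conjI ballI impI)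
  note P = round_filterD[OF p]
  show "adjoin p c \<subseteq> carrier L" by (auto simp: adjoin_def)
  show "adjoin p c \<inter> bounded_elems L \<noteq> {}"
    using P(4) adjoin_superset[OF p] c by blast
  show "y \<in> adjoin p c" if x: "x \<in> adjoin p c" and y: "y \<in> carrier L" "x \<sqsubseteq> y" for x y
  proof -
    obtain u v where uv: "u \<in> p" "v \<in> carrier L" "c \<lless> v" "u \<sqinter> v \<sqsubseteq> x" "x \<in> carrier L"
      using x unfolding adjoin_def by blast
    then have "u \<sqinter> v \<sqsubseteq> y"
      using y P(1)[OF uv(1)] le_trans[of "u \<sqinter> v" x y] by simp
    then show ?thesis using adjoinI[OF uv(1-3)] y(1) by blast
  qed
  show "s \<sqinter> t \<in> adjoin p c" if s: "s \<in> adjoin p c" and t: "t \<in> adjoin p c" for s t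
  proof -
    obtain x y x' y' where *: "x \<in> p" "y \<in> carrier L" "c \<lless> y" "x \<sqinter> y \<sqsubseteq> s"
      "x' \<in> p" "y' \<in> carrier L" "c \<lless> y'" "x' \<sqinter> y' \<sqsubseteq> t" "s \<in> carrier L" "t \<in> carrier L"
      using s t unfolding adjoin_def by blast
    then have car: "x \<in> carrier L" "x' \<in> carrier L" using P(1) by auto
    have "c \<lless> y \<sqinter> y'"
      using well_inside_meet[of c y c y'] * c by simp
    moreover have "(x \<sqinter> x') \<sqinter> (y \<sqinter> y') \<sqsubseteq> s \<sqinter> t"
    proof -
      have "(x \<sqinter> x') \<sqinter> (y \<sqinter> y') \<sqsubseteq> x \<sqinter> y" "(x \<sqinter> x') \<sqinter> (y \<sqinter> y') \<sqsubseteq> x' \<sqinter> y'"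
        by (rule meet_mono; use * car in \<open>simp add: meet_left meet_right\<close>)+
      then show ?thesis
        using * car le_trans[of _ "x \<sqinter> y" s] le_trans[of _ "x' \<sqinter> y'" t] by simp
    qed
    ultimately show ?thesis
      using adjoinI[OF P(2)[OF *(1,5)], of "y \<sqinter> y'"] * by simp
  qed
  show "\<exists>s \<in> adjoin p c. s \<lless> t" if t: "t \<in> adjoin p c" for t
  proof -
    obtain x y where *: "x \<in> p" "y \<in> carrier L" "c \<lless> y" "x \<sqinter> y \<sqsubseteq> t" "t \<in> carrier L"
      using t unfolding adjoin_def by blast
    obtain x' where x': "x' \<in> p" "x' \<lless> x" using P(5)[OF *(1)] by blast
    obtain y' where y': "y' \<in> bounded_elems L" "c \<lless> y'" "y' \<lless> y" using BC1[OF c *(2,3)] by blast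
    have car: "x \<in> carrier L" "x' \<in> carrier L" using * x' P(1) by auto
    have "x' \<sqinter> y' \<lless> t"
      by (rule well_inside_mono[OF well_inside_meet[OF x'(2) y'(3)] le_refl *(4)])
        (use * y'(1) car in simp_all)
    moreover have "x' \<sqinter> y' \<in> adjoin p c"
      using adjoinI[OF x'(1) bounded_closed[OF y'(1)] y'(2)] y'(1) car by simp
    ultimately show ?thesis by blast
  qed
qed

lemma adjoin_contains:
  assumes "round_filter p" "c \<lless> y" "y \<in> carrier L"
  shows "y \<in> adjoin p c"
  by (rule adjoinI[OF round_filterD(6)[OF assms(1)] assms(3,2)]) (use assms in simp_all)

lemma round_filter_well_inside:
  assumes a: "a \<in> bounded_elems L"
  shows "round_filter {x \<in> carrier L. a \<lless> x}"
  unfolding round_filter_def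
proof (intro conjI ballI impI)
  obtain b where "b \<in> bounded_elems L" "a \<lless> b"
    using BC1[OF a _ well_inside_top] a by blast
  then show "{x \<in> carrier L. a \<lless> x} \<inter> bounded_elems L \<noteq> {}" by blast
  show "\<exists>y \<in> {x \<in> carrier L. a \<lless> x}. y \<lless> x" if "x \<in> {x \<in> carrier L. a \<lless> x}" for x
    using BC1[OF a, of x] that by auto
  show "x \<sqinter> y \<in> {x \<in> carrier L. a \<lless> x}"
    if "x \<in> {x \<in> carrier L. a \<lless> x}" "y \<in> {x \<in> carrier L. a \<lless> x}" for x y
    using that well_inside_meet[of a x a y] a by simp
next
  show "y \<in> {x \<in> carrier L. a \<lless> x}"
    if "x \<in> {x \<in> carrier L. a \<lless> x}" "y \<in> carrier L" "x \<sqsubseteq> y" for x y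
    using that well_inside_mono[of a x a y] a by simp
qed simp

text \<open>The prime filter theorem for round filters. The predicate \<open>S\<close> is a property that all
  elements of the filter keep; it is prime in the sense that it is never lost by both halves of
  a cut of an element, where the halves may overlap between \<open>c\<close> and \<open>e\<close>.\<close>

theorem point_exists:
  assumes a: "a \<in> bounded_elems L"
    and up: "\<And>x y. \<lbrakk>S x; x \<sqsubseteq> y; x \<in> carrier L; y \<in> carrier L\<rbrakk> \<Longrightarrow> S y"
    and bot: "\<not> S \<bottom>"
    and start: "\<And>x. \<lbrakk>x \<in> carrier L; a \<lless> x\<rbrakk> \<Longrightarrow> S x"
    and split: "\<And>x c e. \<lbrakk>S x; c \<lless> e; x \<in> carrier L; c \<in> carrier L; e \<in> carrier L\<rbrakk>
                  \<Longrightarrow> S (x \<sqinter> e) \<or> S (x \<sqinter> \<sim>c)"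
  shows "\<exists>p. point p \<and> {x \<in> carrier L. a \<lless> x} \<subseteq> p \<and> (\<forall>x \<in> p. S x)"
proof -
  define \<F> where "\<F> = {p. round_filter p \<and> {x \<in> carrier L. a \<lless> x} \<subseteq> p \<and> (\<forall>x \<in> p. S x)}"
  have "\<exists>p \<in> \<F>. \<forall>q \<in> \<F>. p \<subseteq> q \<longrightarrow> q = p"
  proof (rule subset_Zorn_nonempty)
    show "\<F> \<noteq> {}"
      using round_filter_well_inside[OF a] start unfolding \<F>_def by blast
    fix \<C> assume \<C>: "\<C> \<noteq> {}" "subset.chain \<F> \<C>"
    then have sub: "\<C> \<subseteq> \<F>" and lin: "\<And>p q. \<lbrakk>p \<in> \<C>; q \<in> \<C>\<rbrakk> \<Longrightarrow> p \<subseteq> q \<or> q \<subseteq> p"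
      unfolding subset.chain_def by blast+
    have rf: "round_filter p" if "p \<in> \<C>" for p using that sub unfolding \<F>_def by blast
    have "round_filter (\<Union>\<C>)"
      unfolding round_filter_def
    proof (intro conjI ballI impI)
      show "\<Union>\<C> \<subseteq> carrier L"
        using rf round_filterD(1) by blast
      show "y \<in> \<Union>\<C>" if "x \<in> \<Union>\<C>" "y \<in> carrier L" "x \<sqsubseteq> y" for x y
        using that rf round_filterD(3) by blast
      show "\<Union>\<C> \<inter> bounded_elems L \<noteq> {}"
        using \<C>(1) rf round_filterD(4) by blast
      show "x \<sqinter> y \<in> \<Union>\<C>" if xy: "x \<in> \<Union>\<C>" "y \<in> \<Union>\<C>" for x y
      proof -
        obtain p q where pq: "p \<in> \<C>" "q \<in> \<C>" "x \<in> p" "y \<in> q" using xy by blast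
        then have "{x, y} \<subseteq> p \<or> {x, y} \<subseteq> q" using lin[of p q] by blast
        then show ?thesis using pq rf round_filterD(2) by blast
      qed
      show "\<exists>y \<in> \<Union>\<C>. y \<lless> x" if "x \<in> \<Union>\<C>" for x
        using that rf round_filterD(5) by blast
    qed
    then show "\<Union>\<C> \<in> \<F>"
      using \<C>(1) sub unfolding \<F>_def by blast
  qed
  then obtain p where pF: "p \<in> \<F>" and max: "\<And>q. \<lbrakk>q \<in> \<F>; p \<subseteq> q\<rbrakk> \<Longrightarrow> q = p" by blast
  then have p: "round_filter p" and ap: "{x \<in> carrier L. a \<lless> x} \<subseteq> p" and Sp: "\<And>x. x \<in> p \<Longrightarrow> S x"
    unfolding \<F>_def by blast+
  note P = round_filterD[OF p]
  have absorb: "y \<in> p"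
    if c: "c \<in> bounded_elems L" "c \<lless> y" "y \<in> carrier L"
      and keep: "\<And>x y. \<lbrakk>x \<in> p; y \<in> carrier L; c \<lless> y\<rbrakk> \<Longrightarrow> S (x \<sqinter> y)" for c y
  proof -
    have "S t" if t: "t \<in> adjoin p c" for t
    proof -
      obtain u v where uv: "u \<in> p" "v \<in> carrier L" "c \<lless> v" "u \<sqinter> v \<sqsubseteq> t" "t \<in> carrier L"
        using t unfolding adjoin_def by blast
      then show ?thesis using up[OF keep[OF uv(1-3)] uv(4)] P(1)[OF uv(1)] by simp
    qed
    then have "adjoin p c \<in> \<F>"
      using adjoin_round[OF p c(1)] adjoin_superset[OF p, of c] ap c(1) unfolding \<F>_def by blast
    then have "adjoin p c = p"
      using max adjoin_superset[OF p] c(1) by blast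
    then show ?thesis using adjoin_contains[OF p c(2,3)] by blast
  qed
  have "\<sim>c \<in> p \<or> e \<in> p" if c: "c \<in> bounded_elems L" and e: "e \<in> carrier L" and ce: "c \<lless> e" for c e
  proof (rule ccontr)
    \<comment> \<open>By maximality, neither \<open>c2\<close> nor the complement of \<open>c1\<close> can be adjoined to \<open>p\<close> without losing
      \<open>S\<close>, for some \<open>c1 \<lless> c2\<close> between \<open>c\<close> and \<open>e\<close>; but one of these two halves keeps \<open>S\<close>. The
      element \<open>z\<close> serves to make the complement bounded.\<close>
    assume contra: "\<not> (\<sim>c \<in> p \<or> e \<in> p)"
    obtain c2 where c2: "c2 \<in> bounded_elems L" "c \<lless> c2" "c2 \<lless> e" using BC1[OF c e ce] by blast
    obtain c1 where c1: "c1 \<in> bounded_elems L" "c \<lless> c1" "c1 \<lless> c2"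
      using BC1[OF c _ c2(2)] c2(1) by blast
    obtain z where z: "z \<in> p" "z \<in> bounded_elems L" using P(4) by blast
    note car = P(1)[OF z(1)] bounded_closed[OF c2(1)] bounded_closed[OF c1(1)] bounded_closed[OF c] e
    obtain x1 y1 where 1: "x1 \<in> p" "y1 \<in> carrier L" "c2 \<lless> y1" "\<not> S (x1 \<sqinter> y1)"
      using absorb[OF c2(1,3) e] contra by blast
    have w: "\<sim>c1 \<sqinter> z \<in> bounded_elems L" using z car by (simp add: meet_bounded)
    have "\<sim>c1 \<sqinter> z \<lless> \<sim>c"
      using well_inside_mono[OF well_inside_complement[OF c1(2)]] car by (simp add: meet_left)
    then obtain x2 y2 where 2: "x2 \<in> p" "y2 \<in> carrier L" "\<sim>c1 \<sqinter> z \<lless> y2" "\<not> S (x2 \<sqinter> y2)"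
      using absorb[OF w, of "\<sim>c"] contra car by blast
    define x where "x = (x1 \<sqinter> x2) \<sqinter> z"
    have xp: "x \<in> p" unfolding x_def by (intro P(2) 1(1) 2(1) z(1))
    note car = car P(1)[OF 1(1)] P(1)[OF 2(1)] P(1)[OF xp]
    have "x \<sqsubseteq> x1 \<sqinter> x2" "x \<sqsubseteq> z"
      unfolding x_def by (rule meet_left meet_right; use car in simp)+
    then have le: "x \<sqsubseteq> x1" "x \<sqsubseteq> x2" "x \<sqsubseteq> z"
      using car by simp_all
    have y1: "c2 \<sqsubseteq> y1" and y2: "\<sim>c1 \<sqinter> z \<sqsubseteq> y2"
      using well_inside_le[OF 1(3)] well_inside_le[OF 2(3)] 1(2) 2(2) car w by auto
    have "x \<sqinter> c2 \<sqsubseteq> x1 \<sqinter> y1"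
      by (rule meet_mono[OF le(1) y1]) (use 1 car in simp_all)
    moreover have "x \<sqinter> \<sim>c1 \<sqsubseteq> x2 \<sqinter> y2"
    proof -
      have "x \<sqinter> \<sim>c1 \<sqsubseteq> x2" "x \<sqinter> \<sim>c1 \<sqsubseteq> z" "x \<sqinter> \<sim>c1 \<sqsubseteq> \<sim>c1"
        using car le_trans[OF meet_left le(2), of "\<sim>c1"] le_trans[OF meet_left le(3), of "\<sim>c1"]
        by (simp_all add: meet_right)
      then show ?thesis
        using 2(2) car le_trans[of "x \<sqinter> \<sim>c1" "\<sim>c1 \<sqinter> z" y2] y2 by simp
    qed
    ultimately have "\<not> S (x \<sqinter> c2)" "\<not> S (x \<sqinter> \<sim>c1)"
      using up[of "x \<sqinter> c2" "x1 \<sqinter> y1"] up[of "x \<sqinter> \<sim>c1" "x2 \<sqinter> y2"] 1(2,4) 2(2,4) car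
      by (auto simp del: le_meet_iff)
    then show False
      using split[OF Sp[OF xp] c1(3)] car by simp
  qed
  then have "point p"
    unfolding point_def using p Sp bot by blast
  with ap Sp show ?thesis by blast
qed

end

section \<open>The space of points of a complete local contact algebra\<close>

text \<open>\<open>d\<close> identifies \<open>L\<close> with the algebra of regular closed sets of \<open>X\<close>. Carrying the
  identification along as a parameter treats abstract algebras and algebras of sets alike, and lets
  an algebra of sets be copied to another type.\<close>

locale regular_closed_representation =
  fixes X :: "'a topology" and L :: "('b, 'm) local_contact_lattice_scheme" (structure)
    and d :: "'b \<Rightarrow> 'a set"
  assumes bij: "bij_betw d (carrier L) (regular_closed_sets X)"
    and eq_L: "eq L = (=)"
    and le_iff: "\<lbrakk>a \<in> carrier L; b \<in> carrier L\<rbrakk> \<Longrightarrow> a \<sqsubseteq> b \<longleftrightarrow> d a \<subseteq> d b"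
    and contact_iff: "\<lbrakk>a \<in> carrier L; b \<in> carrier L\<rbrakk> \<Longrightarrow> a \<bowtie> b \<longleftrightarrow> d a \<inter> d b \<noteq> {}"
    and bounded_eq: "bounded_elems L = {a \<in> carrier L. compactin X (d a)}"

context local_contact_algebra
begin

definition points :: "'a set set" where
  "points = {p. point p}"

text \<open>The open set \<open>basic a\<close> and the closed set \<open>extent a\<close> become the interior and the
  closure of one another.\<close>

definition basic :: "'a \<Rightarrow> 'a set set" where
  "basic a = {p \<in> points. a \<in> p}"

definition extent :: "'a \<Rightarrow> 'a set set" where
  "extent a = {p \<in> points. \<sim>a \<notin> p}"

definition space :: "'a set topology" where
  "space = topology (\<lambda>U. U \<subseteq> points \<and> (\<forall>p \<in> U. \<exists>a \<in> p. basic a \<subseteq> U))"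

lemma pointsD:
  assumes "p \<in> points"
  shows "round_filter p" "\<bottom> \<notin> p"
    "\<lbrakk>c \<lless> e; c \<in> bounded_elems L; e \<in> carrier L\<rbrakk> \<Longrightarrow> \<sim>c \<in> p \<or> e \<in> p"
  using assms unfolding points_def point_def by auto

lemmas points_filterD = round_filterD[OF pointsD(1)]

text \<open>Primeness extends to unbounded elements, because a point has a bounded element with which
  they can be met.\<close>

lemma points_well_inside:
  assumes p: "p \<in> points" and c: "c \<lless> e" "c \<in> carrier L" "e \<in> carrier L"
  shows "\<sim>c \<in> p \<or> e \<in> p"
proof -
  note P = points_filterD[OF p]
  obtain z where z: "z \<in> p" "z \<in> bounded_elems L" using P(4) by blast
  have zc: "z \<in> carrier L" using z(2) by simp
  have cz: "c \<sqinter> z \<in> bounded_elems L" using z c by (simp add: meet_bounded)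
  have "c \<sqinter> z \<lless> e"
    by (rule well_inside_mono[OF c(1) meet_left le_refl]) (use c zc in simp_all)
  then have "\<sim>(c \<sqinter> z) \<in> p \<or> e \<in> p" using pointsD(3)[OF p _ cz c(3)] by blast
  moreover have "\<sim>c \<in> p" if "\<sim>(c \<sqinter> z) \<in> p"
  proof -
    have "\<sim>(c \<sqinter> z) \<sqinter> z \<sqsubseteq> \<sim>c"
      using meet_join_distrib[of z "\<sim>c" "\<sim>z"] c zc
      by (simp add: complement_meet meet_comm[of L "\<sim>c \<squnion> \<sim>z" z] meet_right)
    then show ?thesis using P(3)[OF P(2)[OF that z(1)]] c by simp
  qed
  ultimately show ?thesis by blast
qed

lemma points_complement_notin:
  assumes "p \<in> points" "a \<in> p"
  shows "\<sim>a \<notin> p"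
proof
  assume "\<sim>a \<in> p"
  then have "a \<sqinter> \<sim>a \<in> p" by (rule points_filterD(2)[OF assms])
  then show False using points_filterD(1)[OF assms] pointsD(2)[OF assms(1)] by simp
qed

lemma basic_subset_extent: "basic a \<subseteq> extent a"
  unfolding basic_def extent_def using points_complement_notin by blast

lemma basic_subset_points: "basic a \<subseteq> points"
  unfolding basic_def by blast

lemma basic_meet:
  assumes "a \<in> carrier L" "b \<in> carrier L"
  shows "basic (a \<sqinter> b) = basic a \<inter> basic b"
proof -
  have "a \<sqinter> b \<in> p \<longleftrightarrow> a \<in> p \<and> b \<in> p" if p: "p \<in> points" for p
  proof (intro iffI conjI)
    assume ab: "a \<sqinter> b \<in> p"
    show "a \<in> p" by (rule points_filterD(3)[OF p ab meet_left[OF assms] assms(1)])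
    show "b \<in> p" by (rule points_filterD(3)[OF p ab meet_right[OF assms] assms(2)])
  next
    assume "a \<in> p \<and> b \<in> p"
    then show "a \<sqinter> b \<in> p" using points_filterD(2)[OF p] by simp
  qed
  then show ?thesis unfolding basic_def by blast
qed

lemma openin_space: "openin space U \<longleftrightarrow> U \<subseteq> points \<and> (\<forall>p \<in> U. \<exists>a \<in> p. basic a \<subseteq> U)"
proof -
  have "istopology (\<lambda>U. U \<subseteq> points \<and> (\<forall>p \<in> U. \<exists>a \<in> p. basic a \<subseteq> U))"
    unfolding istopology_def
  proof (intro conjI allI impI ballI)
    fix S T p
    assume S: "S \<subseteq> points \<and> (\<forall>p \<in> S. \<exists>a \<in> p. basic a \<subseteq> S)"
      and T: "T \<subseteq> points \<and> (\<forall>p \<in> T. \<exists>a \<in> p. basic a \<subseteq> T)"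
    then show "S \<inter> T \<subseteq> points" by blast
    assume p: "p \<in> S \<inter> T"
    obtain a where a: "a \<in> p" "basic a \<subseteq> S" using S p by blast
    obtain b where b: "b \<in> p" "basic b \<subseteq> T" using T p by blast
    have pp: "p \<in> points" using S p by blast
    then have "a \<sqinter> b \<in> p" "basic (a \<sqinter> b) \<subseteq> S \<inter> T"
      using a b points_filterD(1,2)[OF pp] basic_meet[of a b] by auto
    then show "\<exists>a \<in> p. basic a \<subseteq> S \<inter> T" by blast
  next
    fix \<K> p
    assume K: "\<forall>S \<in> \<K>. S \<subseteq> points \<and> (\<forall>p \<in> S. \<exists>a \<in> p. basic a \<subseteq> S)"
    then show "\<Union>\<K> \<subseteq> points" by blast
    assume "p \<in> \<Union>\<K>"
    then obtain S where S: "S \<in> \<K>" "p \<in> S" by blast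
    then obtain a where "a \<in> p" "basic a \<subseteq> S"
      using conjunct2[OF bspec[OF K S(1)]] by meson
    with S show "\<exists>a \<in> p. basic a \<subseteq> \<Union>\<K>" by blast
  qed
  then show ?thesis unfolding space_def by simp
qed

lemma openin_basic: "openin space (basic a)"
  unfolding openin_space basic_def by blast

lemma topspace_space [simp]: "topspace space = points"
proof (rule subset_antisym)
  show "topspace space \<subseteq> points"
    using openin_topspace[of space] unfolding openin_space by blast
  have "openin space points"
    unfolding openin_space using points_filterD(4) basic_subset_points by blast
  then show "points \<subseteq> topspace space" by (rule openin_subset)
qed

lemma extent_eq: "a \<in> carrier L \<Longrightarrow> extent a = points - basic (\<sim>a)"
  unfolding extent_def basic_def by blast

lemma closedin_extent: "a \<in> carrier L \<Longrightarrow> closedin space (extent a)"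
  using closedin_diff[OF closedin_topspace openin_basic] extent_eq by simp

text \<open>This is the prime filter theorem for the property of meeting \<open>a\<close> and \<open>b\<close> in parts that
  are in contact. The case \<open>a = b\<close> shows that there are enough points.\<close>

lemma contact_point:
  assumes a: "a \<in> bounded_elems L" and b: "b \<in> carrier L" and ab: "a \<bowtie> b"
  shows "\<exists>p \<in> points. p \<in> extent a \<inter> extent b \<and> {x \<in> carrier L. a \<lless> x} \<subseteq> p"
proof -
  let ?S = "\<lambda>x. a \<sqinter> x \<bowtie> b \<sqinter> x"
  have ac: "a \<in> carrier L" using a by simp
  have "\<exists>p. point p \<and> {x \<in> carrier L. a \<lless> x} \<subseteq> p \<and> (\<forall>x \<in> p. ?S x)"
  proof (rule point_exists[OF a])
    show "?S y" if "?S x" "x \<sqsubseteq> y" "x \<in> carrier L" "y \<in> carrier L" for x y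
      by (rule contact_mono[OF that(1) meet_mono meet_mono]) (use that ac b in simp_all)
    show "\<not> ?S \<bottom>"
      using C2[of "a \<sqinter> \<bottom>" "b \<sqinter> \<bottom>"] ac b by (auto simp: meet_comm[of L _ \<bottom>])
    show "?S x" if x: "x \<in> carrier L" "a \<lless> x" for x
    proof -
      have "\<not> a \<bowtie> b \<sqinter> \<sim>x"
        using x ac b contact_mono[of a "b \<sqinter> \<sim>x" a "\<sim>x"] unfolding well_inside_def
        by (auto simp: meet_right)
      then have "a \<bowtie> b \<sqinter> x"
        using contact_split_right[OF ab ac b x(1)] by blast
      moreover have "a \<sqinter> x = a"
        using well_inside_le[OF x(2) ac x(1)] le_iff_join ac x(1) by metis
      ultimately show ?thesis by simp
    qed
    fix x c e assume S: "?S x" and ce: "c \<lless> e" and car: "x \<in> carrier L" "c \<in> carrier L" "e \<in> carrier L"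
    note car = car ac b
    let ?a = "a \<sqinter> x" and ?b = "b \<sqinter> x"
    have far: "\<not> u \<bowtie> v" if "u \<sqsubseteq> c" "v \<sqsubseteq> \<sim>e" "u \<in> carrier L" "v \<in> carrier L" for u v
      using ce contact_mono[of u v c "\<sim>e"] that car unfolding well_inside_def by auto
    have le: "c \<sqsubseteq> e" using well_inside_le ce car by blast
    have E: "?S (x \<sqinter> e)" if "u \<bowtie> v" "u \<sqsubseteq> ?a" "u \<sqsubseteq> e" "v \<sqsubseteq> ?b" "v \<sqsubseteq> e"
      "u \<in> carrier L" "v \<in> carrier L" for u v
      by (rule contact_mono[OF that(1)]) (use that car in simp_all)
    have N: "?S (x \<sqinter> \<sim>c)" if "u \<bowtie> v" "u \<sqsubseteq> ?a" "u \<sqsubseteq> \<sim>c" "v \<sqsubseteq> ?b" "v \<sqsubseteq> \<sim>c"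
      "u \<in> carrier L" "v \<in> carrier L" for u v
      by (rule contact_mono[OF that(1)]) (use that car in simp_all)
    \<comment> \<open>Cutting at \<open>c\<close> and at \<open>e\<close> leaves pieces \<open>s\<close> and \<open>t\<close> in contact. As nothing below \<open>c\<close>
      touches anything below \<open>\<sim>e\<close>, both lie below \<open>e\<close> or both lie below \<open>\<sim>c\<close>.\<close>
    show "?S (x \<sqinter> e) \<or> ?S (x \<sqinter> \<sim>c)"
    proof -
      have cut: "\<exists>u' v'. u' \<bowtie> v' \<and> u' \<in> carrier L \<and> v' \<in> carrier L \<and> u' \<sqsubseteq> u \<and> v' \<sqsubseteq> v \<and>
          (u' \<sqsubseteq> w \<or> u' \<sqsubseteq> \<sim>w) \<and> (v' \<sqsubseteq> w \<or> v' \<sqsubseteq> \<sim>w)"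
        if uv: "u \<bowtie> v" "u \<in> carrier L" "v \<in> carrier L" and w: "w \<in> carrier L" for u v w
      proof -
        obtain u' where u': "u' \<in> carrier L" "u' \<bowtie> v" "u' \<sqsubseteq> u" "u' \<sqsubseteq> w \<or> u' \<sqsubseteq> \<sim>w"
          using contact_cut[OF uv w] .
        obtain v' where v': "v' \<in> carrier L" "v' \<bowtie> u'" "v' \<sqsubseteq> v" "v' \<sqsubseteq> w \<or> v' \<sqsubseteq> \<sim>w"
          using contact_cut[OF C3[OF u'(1) uv(3) u'(2)] uv(3) u'(1) w] .
        show ?thesis
          using u' v' C3[OF v'(1) u'(1) v'(2)] by metis
      qed
      obtain u v where uv: "u \<bowtie> v" "u \<in> carrier L" "v \<in> carrier L" "u \<sqsubseteq> ?a" "v \<sqsubseteq> ?b"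
        "u \<sqsubseteq> c \<or> u \<sqsubseteq> \<sim>c" "v \<sqsubseteq> c \<or> v \<sqsubseteq> \<sim>c"
        using cut[OF S, of c] car by auto
      obtain s t where st: "s \<bowtie> t" "s \<in> carrier L" "t \<in> carrier L" "s \<sqsubseteq> u" "t \<sqsubseteq> v"
        "s \<sqsubseteq> e \<or> s \<sqsubseteq> \<sim>e" "t \<sqsubseteq> e \<or> t \<sqsubseteq> \<sim>e"
        using cut[OF uv(1-3), of e] car by auto
      have le': "s \<sqsubseteq> ?a" "t \<sqsubseteq> ?b" "s \<sqsubseteq> c \<or> s \<sqsubseteq> \<sim>c" "t \<sqsubseteq> c \<or> t \<sqsubseteq> \<sim>c"
        using st uv car le_trans[OF st(4)] le_trans[OF st(5)] by auto
      have ce': "s \<sqsubseteq> c \<Longrightarrow> s \<sqsubseteq> e" "t \<sqsubseteq> c \<Longrightarrow> t \<sqsubseteq> e"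
        using le st car le_trans[of s c e] le_trans[of t c e] by auto
      have "\<not> (s \<sqsubseteq> c \<and> t \<sqsubseteq> \<sim>e)" "\<not> (t \<sqsubseteq> c \<and> s \<sqsubseteq> \<sim>e)"
        using far[of s t] far[of t s] st C3[OF st(2,3,1)] by auto
      then have "s \<sqsubseteq> e \<and> t \<sqsubseteq> e \<or> s \<sqsubseteq> \<sim>c \<and> t \<sqsubseteq> \<sim>c"
        using le'(3,4) ce' st(6,7) by blast
      then show ?thesis using E[OF st(1) le'(1)] N[OF st(1) le'(1)] le'(2) st(2,3) by blast
    qed
  qed
  then obtain p where p: "point p" "{x \<in> carrier L. a \<lless> x} \<subseteq> p" "\<And>x. x \<in> p \<Longrightarrow> ?S x" by blast
  have "\<sim>a \<notin> p" "\<sim>b \<notin> p"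
    using p(3)[of "\<sim>a"] p(3)[of "\<sim>b"] C2[of \<bottom> "b \<sqinter> \<sim>a"] C2[of "a \<sqinter> \<sim>b" \<bottom>] ac b by auto
  then show ?thesis using p unfolding extent_def points_def by blast
qed

lemma basic_eq_empty_iff:
  assumes "a \<in> carrier L"
  shows "basic a = {} \<longleftrightarrow> a = \<bottom>"
proof
  show "basic a = {}" if "a = \<bottom>"
    using that pointsD(2) unfolding basic_def by blast
  show "a = \<bottom>" if "basic a = {}"
  proof (rule ccontr)
    assume "a \<noteq> \<bottom>"
    then obtain b where b: "b \<in> bounded_elems L" "b \<noteq> \<bottom>" "b \<lless> a"
      using BC3[OF assms] by blast
    then obtain p where "p \<in> points" "{x \<in> carrier L. b \<lless> x} \<subseteq> p"
      using contact_point[of b b] C1[of b] by auto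
    then show False using that b(3) assms unfolding basic_def by blast
  qed
qed

lemma extent_subset_iff:
  assumes ab: "a \<in> carrier L" "b \<in> carrier L"
  shows "extent a \<subseteq> extent b \<longleftrightarrow> a \<sqsubseteq> b"
proof
  assume "a \<sqsubseteq> b"
  then show "extent a \<subseteq> extent b"
    using ab points_filterD(3)[of _ "\<sim>b" "\<sim>a"] unfolding extent_def by auto
next
  assume sub: "extent a \<subseteq> extent b"
  have "basic (a \<sqinter> \<sim>b) \<subseteq> extent a \<inter> basic (\<sim>b)"
    using basic_subset_extent[of a] ab by (auto simp: basic_meet)
  then have "basic (a \<sqinter> \<sim>b) = {}"
    using sub unfolding extent_def basic_def by blast
  then show "a \<sqsubseteq> b"
    using ab basic_eq_empty_iff[of "a \<sqinter> \<sim>b"] meet_eq_bottom_iff[of a "\<sim>b"] by simp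
qed

lemma extent_join:
  assumes "a \<in> carrier L" "b \<in> carrier L"
  shows "extent (a \<squnion> b) = extent a \<union> extent b"
proof -
  have "\<sim>(a \<squnion> b) = \<sim>a \<sqinter> \<sim>b"
    using complement_meet[of "\<sim>a" "\<sim>b"] assms by (metis complement_closed complement_complement meet_closed)
  then show ?thesis
    using basic_meet[of "\<sim>a" "\<sim>b"] assms by (auto simp: extent_eq)
qed

lemma extent_contact_iff:
  assumes ab: "a \<in> carrier L" "b \<in> carrier L"
  shows "extent a \<inter> extent b \<noteq> {} \<longleftrightarrow> a \<bowtie> b"
proof
  assume "extent a \<inter> extent b \<noteq> {}"
  then obtain p where "p \<in> points" "\<sim>a \<notin> p" "\<sim>b \<notin> p"
    unfolding extent_def by blast
  then show "a \<bowtie> b"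
    using points_well_inside[of p a "\<sim>b"] ab unfolding well_inside_def by auto
next
  assume "a \<bowtie> b"
  then obtain c where c: "c \<in> bounded_elems L" "b \<bowtie> c \<sqinter> a"
    using BC2[of b a] C3 ab by blast
  then obtain p where "p \<in> extent (c \<sqinter> a) \<inter> extent b"
    using contact_point[of "c \<sqinter> a" b] C3[of b "c \<sqinter> a"] meet_bounded(2)[of c a] ab by auto
  moreover have "extent (c \<sqinter> a) \<subseteq> extent a"
    using c ab by (simp add: extent_subset_iff meet_right)
  ultimately show "extent a \<inter> extent b \<noteq> {}" by blast
qed

lemma extent_subset_basic:
  "\<lbrakk>a \<lless> b; a \<in> carrier L; b \<in> carrier L\<rbrakk> \<Longrightarrow> extent a \<subseteq> basic b"
  using points_well_inside unfolding extent_def basic_def by blast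

lemma closure_basic:
  assumes a: "a \<in> carrier L"
  shows "space closure_of (basic a) = extent a"
proof (rule subset_antisym)
  show "space closure_of (basic a) \<subseteq> extent a"
    by (rule closure_of_minimal[OF basic_subset_extent closedin_extent[OF a]])
  show "extent a \<subseteq> space closure_of (basic a)"
  proof
    fix p assume "p \<in> extent a"
    then have p: "p \<in> points" "\<sim>a \<notin> p" unfolding extent_def by auto
    have "\<exists>q. q \<in> basic a \<and> q \<in> T" if T: "p \<in> T" "openin space T" for T
    proof -
      obtain b where b: "b \<in> p" "basic b \<subseteq> T" using T unfolding openin_space by blast
      have bc: "b \<in> carrier L" using points_filterD(1)[OF p(1) b(1)] .
      have "a \<sqinter> b \<noteq> \<bottom>"
        using points_filterD(3)[OF p(1) b(1), of "\<sim>a"] p(2) a bc meet_eq_bottom_iff[of b a]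
        by (auto simp: meet_comm[of L b a])
      then have "basic a \<inter> basic b \<noteq> {}"
        using basic_eq_empty_iff[of "a \<sqinter> b"] a bc by (simp add: basic_meet)
      then show ?thesis using b(2) by blast
    qed
    then show "p \<in> space closure_of (basic a)"
      unfolding in_closure_of using p(1) by simp
  qed
qed

lemma interior_extent:
  assumes a: "a \<in> carrier L"
  shows "space interior_of (extent a) = basic a"
proof -
  have "space interior_of (extent a) = points - space closure_of (basic (\<sim>a))"
    using interior_of_complement[of space "basic (\<sim>a)"] extent_eq[OF a] by simp
  also have "\<dots> = basic a"
    using closure_basic[of "\<sim>a"] a unfolding extent_def basic_def by auto
  finally show ?thesis .
qed

lemma Hausdorff_space_points: "Hausdorff_space space"
  unfolding Hausdorff_space_def
proof (intro allI impI)
  have sep: "\<exists>U V. openin space U \<and> openin space V \<and> p \<in> U \<and> q \<in> V \<and> disjnt U V"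
    if p: "p \<in> points" and q: "q \<in> points" and e: "e \<in> p" "e \<notin> q" for p q e
  proof -
    obtain c where c: "c \<in> p" "c \<lless> e" using points_filterD(5)[OF p e(1)] by blast
    have car: "c \<in> carrier L" "e \<in> carrier L" using points_filterD(1)[OF p] c(1) e(1) by auto
    have "\<sim>c \<in> q" using points_well_inside[OF q c(2) car] e(2) by blast
    moreover have "disjnt (basic c) (basic (\<sim>c))"
      using points_complement_notin unfolding disjnt_def basic_def by blast
    ultimately show ?thesis
      using openin_basic p q c(1) unfolding basic_def by blast
  qed
  fix p q assume "p \<in> topspace space \<and> q \<in> topspace space \<and> p \<noteq> q"
  then have p: "p \<in> points" and q: "q \<in> points" and "\<exists>e. e \<in> p \<and> e \<notin> q \<or> e \<in> q \<and> e \<notin> p" by auto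
  then obtain e where "e \<in> p \<and> e \<notin> q \<or> e \<in> q \<and> e \<notin> p" by blast
  then show "\<exists>U V. openin space U \<and> openin space V \<and> p \<in> U \<and> q \<in> V \<and> disjnt U V"
    using sep[OF p q] sep[OF q p] disjnt_sym by metis
qed

text \<open>The elements whose extent is covered by finitely many members of an open cover form an
  ideal \<open>J\<close>. If \<open>a\<close> were not in \<open>J\<close>, there would be a point in the extent of \<open>a\<close> all of whose
  elements \<open>x\<close> satisfy \<open>a \<sqinter> x \<notin> J\<close>; but a point in a member of the cover has, by roundness, an
  element whose extent is inside that member.\<close>

lemma compactin_extent:
  assumes a: "a \<in> bounded_elems L"
  shows "compactin space (extent a)"
  unfolding compactin_def
proof (intro conjI allI impI)
  show "extent a \<subseteq> topspace space" by (auto simp: extent_def)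
  have ac: "a \<in> carrier L" using a by simp
  fix \<U> assume \<U>: "(\<forall>U \<in> \<U>. openin space U) \<and> extent a \<subseteq> \<Union>\<U>"
  define J where "J = {x \<in> carrier L. \<exists>F. finite F \<and> F \<subseteq> \<U> \<and> extent x \<subseteq> \<Union>F}"
  have "a \<in> J"
  proof (rule ccontr)
    assume aJ: "a \<notin> J"
    have J_down: "x \<in> J" if "y \<in> J" "x \<sqsubseteq> y" "x \<in> carrier L" for x y
    proof -
      have "extent x \<subseteq> extent y" using that extent_subset_iff[of x y] unfolding J_def by blast
      then show ?thesis using that unfolding J_def by blast
    qed
    have J_join: "x \<in> J"
      if x: "y \<in> J" "z \<in> J" "x \<in> carrier L" "extent x \<subseteq> extent y \<union> extent z" for x y z
    proof -
      obtain F F' where "finite F" "F \<subseteq> \<U>" "extent y \<subseteq> \<Union>F"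
        "finite F'" "F' \<subseteq> \<U>" "extent z \<subseteq> \<Union>F'" using x(1,2) unfolding J_def by blast
      then have "finite (F \<union> F') \<and> F \<union> F' \<subseteq> \<U> \<and> extent x \<subseteq> \<Union>(F \<union> F')" using x(4) by blast
      then show ?thesis using x(3) unfolding J_def by blast
    qed
    have "extent \<bottom> = {}"
      using points_filterD(6) unfolding extent_def by auto
    then have J_bot: "\<bottom> \<in> J" unfolding J_def by auto
    have "\<exists>p. point p \<and> {x \<in> carrier L. a \<lless> x} \<subseteq> p \<and> (\<forall>x \<in> p. a \<sqinter> x \<notin> J)"
    proof (rule point_exists[OF a])
      show "a \<sqinter> y \<notin> J" if "a \<sqinter> x \<notin> J" "x \<sqsubseteq> y" "x \<in> carrier L" "y \<in> carrier L" for x y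
        using J_down[of "a \<sqinter> y" "a \<sqinter> x"] meet_mono[OF le_refl, of a x y] that ac
        by (simp del: le_meet_iff) metis
      show "\<not> a \<sqinter> \<bottom> \<notin> J"
        using J_bot ac by (simp add: meet_comm[of L a \<bottom>])
      show "a \<sqinter> x \<notin> J" if x: "x \<in> carrier L" "a \<lless> x" for x
        using aJ well_inside_le[OF x(2) ac x(1)] le_iff_join[OF ac x(1)] by simp
      show "a \<sqinter> (x \<sqinter> e) \<notin> J \<or> a \<sqinter> (x \<sqinter> \<sim>c) \<notin> J"
        if x: "a \<sqinter> x \<notin> J" "c \<lless> e" "x \<in> carrier L" "c \<in> carrier L" "e \<in> carrier L" for x c e
      proof (rule ccontr)
        assume n: "\<not> (a \<sqinter> (x \<sqinter> e) \<notin> J \<or> a \<sqinter> (x \<sqinter> \<sim>c) \<notin> J)"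
        let ?y = "a \<sqinter> x"
        have eq: "a \<sqinter> (x \<sqinter> e) = ?y \<sqinter> e" "a \<sqinter> (x \<sqinter> \<sim>c) = ?y \<sqinter> \<sim>c"
          using x ac by (simp_all add: meet_assoc)
        have yc: "?y \<in> carrier L" using x ac by simp
        have "extent ?y \<subseteq> extent (?y \<sqinter> e) \<union> extent (?y \<sqinter> \<sim>e)"
          using meet_split[OF yc x(5)] x(5) yc
          by (metis complement_closed equalityD1 extent_join meet_closed)
        moreover have "extent (?y \<sqinter> \<sim>e) \<subseteq> extent (?y \<sqinter> \<sim>c)"
          using well_inside_le[OF x(2,4,5)] x yc meet_mono[OF le_refl, of ?y "\<sim>e" "\<sim>c"]
          by (intro iffD2[OF extent_subset_iff]) simp_all
        ultimately have "extent ?y \<subseteq> extent (?y \<sqinter> e) \<union> extent (?y \<sqinter> \<sim>c)" by blast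
        then show False
          using J_join[of "?y \<sqinter> e" "?y \<sqinter> \<sim>c" ?y] n x(1) yc unfolding eq by blast
      qed
    qed
    then obtain p where p: "point p" "{x \<in> carrier L. a \<lless> x} \<subseteq> p" "\<And>x. x \<in> p \<Longrightarrow> a \<sqinter> x \<notin> J"
      by blast
    have pp: "p \<in> points" using p(1) by (simp add: points_def)
    have "\<sim>a \<notin> p" using p(3)[of "\<sim>a"] J_bot ac by auto
    then have "p \<in> extent a" using pp unfolding extent_def by simp
    then obtain U where U: "U \<in> \<U>" "p \<in> U" "openin space U" using \<U> by blast
    then obtain x where x: "x \<in> p" "basic x \<subseteq> U" unfolding openin_space by blast
    obtain y where y: "y \<in> p" "y \<lless> x" using points_filterD(5)[OF pp x(1)] by blast
    have car: "x \<in> carrier L" "y \<in> carrier L" using points_filterD(1)[OF pp] x(1) y(1) by auto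
    have "extent y \<subseteq> \<Union>{U}" using extent_subset_basic[OF y(2) car(2,1)] x(2) by blast
    then have "y \<in> J" using U(1) car(2) unfolding J_def by (intro CollectI conjI exI[of _ "{U}"]) auto
    then have "a \<sqinter> y \<in> J"
      by (rule J_down[OF _ meet_right[OF ac car(2)]]) (use ac car in simp)
    then show False using p(3)[OF y(1)] by blast
  qed
  then show "\<exists>\<F>. finite \<F> \<and> \<F> \<subseteq> \<U> \<and> extent a \<subseteq> \<Union>\<F>"
    unfolding J_def by blast
qed

lemma bounded_if_compactin_extent:
  assumes a: "a \<in> carrier L" and comp: "compactin space (extent a)"
  shows "a \<in> bounded_elems L"
proof -
  let ?\<U> = "basic ` bounded_elems L"
  have "extent a \<subseteq> \<Union>?\<U>"
  proof
    fix p assume "p \<in> extent a"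
    then have p: "p \<in> points" by (simp add: extent_def)
    then show "p \<in> \<Union>?\<U>" using points_filterD(4)[OF p] unfolding basic_def by blast
  qed
  then obtain \<F> where \<F>: "finite \<F>" "\<F> \<subseteq> ?\<U>" "extent a \<subseteq> \<Union>\<F>"
    using comp openin_basic unfolding compactin_def by (metis (no_types, lifting) imageE)
  have "\<exists>b \<in> bounded_elems L. \<Union>\<F> \<subseteq> extent b"
    using \<F>(1,2)
  proof (induction \<F> rule: finite_induct)
    case empty
    then show ?case using bounded_bottom by auto
  next
    case (insert U \<F>)
    then obtain b where b: "b \<in> bounded_elems L" "\<Union>\<F> \<subseteq> extent b" by auto
    obtain c where c: "c \<in> bounded_elems L" "U = basic c" using insert.prems by auto
    have "U \<subseteq> extent (b \<squnion> c)" "\<Union>\<F> \<subseteq> extent (b \<squnion> c)"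
      using b c basic_subset_extent[of c] by (auto simp: extent_join)
    then show ?case using bounded_join[OF c(1) b(1)] by blast
  qed
  then obtain b where "b \<in> bounded_elems L" "\<Union>\<F> \<subseteq> extent b" by auto
  then have "b \<in> bounded_elems L" "extent a \<subseteq> extent b" using \<F>(3) by auto
  then show ?thesis using bounded_down[of b a] a extent_subset_iff[of a b] by simp
qed

lemma locally_compact_space_points: "locally_compact_space space"
  unfolding locally_compact_space_def
proof
  fix p assume "p \<in> topspace space"
  then have p: "p \<in> points" by simp
  then obtain z where "z \<in> p" "z \<in> bounded_elems L" using points_filterD(4)[OF p] by blast
  then have "p \<in> basic z" "compactin space (extent z)"
    using p compactin_extent unfolding basic_def by simp_all
  then have "openin space (basic z) \<and> compactin space (extent z) \<and> p \<in> basic z \<and> basic z \<subseteq> extent z"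
    using openin_basic basic_subset_extent by simp
  then show "\<exists>U K. openin space U \<and> compactin space K \<and> p \<in> U \<and> U \<subseteq> K" by blast
qed

end

text \<open>A regular closed set is the extent of the join of all elements whose basic open set it
  contains. This is where completeness enters.\<close>

theorem (in complete_local_contact_algebra) representation:
  "regular_closed_representation space L extent"
proof
  show "eq L = (=)" by (rule eq_is_equal)
  show "bounded_elems L = {a \<in> carrier L. compactin space (extent a)}"
    using compactin_extent bounded_if_compactin_extent bounded_closed by blast
  show "bij_betw extent (carrier L) (regular_closed_sets space)"
    unfolding bij_betw_def
  proof
    show "inj_on extent (carrier L)"
      by (rule inj_onI, rule le_antisym) (simp_all add: extent_subset_iff[symmetric])
    show "extent ` carrier L = regular_closed_sets space"
    proof (rule subset_antisym)
      show "extent ` carrier L \<subseteq> regular_closed_sets space"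
        unfolding regular_closed_sets_def by (auto simp: interior_extent closure_basic)
      show "regular_closed_sets space \<subseteq> extent ` carrier L"
      proof
        fix K assume "K \<in> regular_closed_sets space"
        then have K: "space closure_of (space interior_of K) = K"
          unfolding regular_closed_sets_def by simp
        let ?U = "space interior_of K"
        define A where "A = {a \<in> carrier L. basic a \<subseteq> ?U}"
        have A: "A \<subseteq> carrier L" unfolding A_def by blast
        define s where "s = \<Squnion>A"
        have s: "s \<in> carrier L" unfolding s_def using A by simp
        have "space closure_of ?U = extent s"
        proof (rule subset_antisym)
          have "?U \<subseteq> extent s"
          proof
            fix q assume q: "q \<in> ?U"
            then obtain a where a: "a \<in> q" "basic a \<subseteq> ?U"
              using openin_interior_of[of space K] unfolding openin_space by blast
            have qp: "q \<in> points" using q interior_of_subset_topspace[of space K] by auto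
            have ac: "a \<in> carrier L" using points_filterD(1)[OF qp a(1)] .
            then have "a \<sqsubseteq> s" unfolding s_def using sup_upper[OF A, of a] a(2) A_def by blast
            then have "s \<in> q" using points_filterD(3)[OF qp a(1)] s by blast
            then show "q \<in> extent s"
              using qp points_complement_notin[OF qp] unfolding extent_def by blast
          qed
          then show "space closure_of ?U \<subseteq> extent s"
            by (rule closure_of_minimal[OF _ closedin_extent[OF s]])
          show "extent s \<subseteq> space closure_of ?U"
          proof
            fix p assume "p \<in> extent s"
            then have p: "p \<in> points" "\<sim>s \<notin> p" unfolding extent_def by auto
            have "\<exists>q. q \<in> ?U \<and> q \<in> T" if T: "p \<in> T" "openin space T" for T
            proof -
              obtain b where b: "b \<in> p" "basic b \<subseteq> T" using T unfolding openin_space by blast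
              have bc: "b \<in> carrier L" using points_filterD(1)[OF p(1) b(1)] .
              have "\<exists>a \<in> A. b \<sqinter> a \<noteq> \<bottom>"
              proof (rule ccontr)
                assume "\<not> (\<exists>a \<in> A. b \<sqinter> a \<noteq> \<bottom>)"
                then have "a \<sqsubseteq> \<sim>b" if "a \<in> A" for a
                  using that meet_eq_bottom_iff[of a b] bc A by (auto simp: meet_comm[of L a b])
                then have "s \<sqsubseteq> \<sim>b" unfolding s_def using sup_least[OF A, of "\<sim>b"] bc by blast
                then have "b \<sqsubseteq> \<sim>s" using complement_le_iff[of "\<sim>b" s] s bc by simp
                then show False using points_filterD(3)[OF p(1) b(1)] p(2) s by blast
              qed
              then obtain a where a: "a \<in> A" "b \<sqinter> a \<noteq> \<bottom>" by blast
              then have "basic b \<inter> basic a \<noteq> {}"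
                using basic_eq_empty_iff[of "b \<sqinter> a"] A bc by (auto simp: basic_meet)
              then show ?thesis using a(1) b(2) unfolding A_def by blast
            qed
            then show "p \<in> space closure_of ?U" unfolding in_closure_of using p(1) by simp
          qed
        qed
        then show "K \<in> extent ` carrier L" using K s by blast
      qed
    qed
  qed
qed (simp_all add: extent_subset_iff extent_contact_iff)

section \<open>The regular closed sets of a locally compact Hausdorff space\<close>

lemma regular_closed_closure: "openin X U \<Longrightarrow> X closure_of U \<in> regular_closed_sets X"
  unfolding regular_closed_sets_def
  by (simp add: subset_antisym closure_of_minimal closure_of_mono interior_of_subset
      closure_of_subset interior_of_maximal openin_subset)

lemma
  assumes "K \<in> regular_closed_sets X"
  shows closure_interior_regular: "X closure_of (X interior_of K) = K"
    and closedin_regular: "closedin X K" and regular_subset: "K \<subseteq> topspace X"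
  using assms closedin_closure_of[of X "X interior_of K"] closure_of_subset_topspace[of X "X interior_of K"]
  unfolding regular_closed_sets_def by simp_all

lemma regular_complement:
  assumes "K \<in> regular_closed_sets X"
  shows "topspace X - X interior_of K \<in> regular_closed_sets X"
    and "X interior_of (topspace X - X interior_of K) = topspace X - K"
proof -
  show "topspace X - X interior_of K \<in> regular_closed_sets X"
    using regular_closed_closure[of X "topspace X - K"] closedin_regular[OF assms]
    by (simp add: closure_of_complement openin_diff)
  show "X interior_of (topspace X - X interior_of K) = topspace X - K"
    using closure_interior_regular[OF assms] by (simp add: interior_of_complement)
qed

text \<open>This supplies the witnesses for the axioms on bounded elements.\<close>

lemma compact_regular_neighbourhood:
  assumes X: "locally_compact_space X" "Hausdorff_space X"
    and C: "compactin X C" and U: "openin X U" "C \<subseteq> U"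
  obtains M where "M \<in> regular_closed_sets X" "compactin X M" "C \<subseteq> X interior_of M" "M \<subseteq> U"
proof -
  have "neighbourhood_base_of (\<lambda>K. compactin X K \<and> closedin X K) X"
    by (rule iffD1[OF locally_compact_regular_space_neighbourhood_base])
      (use locally_compact_Hausdorff_imp_regular_space[OF X] X(1) in simp)
  then have "\<exists>V K. openin X V \<and> (compactin X K \<and> closedin X K) \<and> x \<in> V \<and> V \<subseteq> K \<and> K \<subseteq> W"
    if "openin X W" "x \<in> W" for W x
    using that unfolding neighbourhood_base_of by simp
  then have "\<exists>V K. openin X V \<and> (compactin X K \<and> closedin X K) \<and> x \<in> V \<and> V \<subseteq> K \<and> K \<subseteq> U"
    if "x \<in> C" for x
    using U(1) subsetD[OF U(2) that] by simp
  then obtain V K where VK: "\<And>x. x \<in> C \<Longrightarrow>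
      openin X (V x) \<and> compactin X (K x) \<and> closedin X (K x) \<and> x \<in> V x \<and> V x \<subseteq> K x \<and> K x \<subseteq> U"
    by metis
  have "(\<forall>T \<in> V ` C. openin X T) \<and> C \<subseteq> \<Union>(V ` C)"
    using VK by blast
  then obtain D where D: "finite D" "D \<subseteq> C" "C \<subseteq> \<Union>(V ` D)"
    using C by (metis compactinD finite_subset_image)
  let ?V = "\<Union>(V ` D)" and ?K = "\<Union>(K ` D)"
  have oV: "openin X ?V" using VK D(2) by blast
  have cK: "compactin X ?K" "closedin X ?K"
    using VK D(1,2) by (auto intro!: compactin_Union closedin_Union)
  have sub: "X closure_of ?V \<subseteq> ?K"
    by (rule closure_of_minimal[OF _ cK(2)]) (use VK D(2) in blast)
  show thesis
  proof
    show "X closure_of ?V \<in> regular_closed_sets X" by (rule regular_closed_closure[OF oV])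
    show "compactin X (X closure_of ?V)" by (rule closed_compactin[OF cK(1) sub]) simp
    show "C \<subseteq> X interior_of (X closure_of ?V)"
      using D(3) interior_of_maximal[OF closure_of_subset[OF openin_subset[OF oV]] oV] by blast
    show "X closure_of ?V \<subseteq> U" using sub VK D(2) by blast
  qed
qed

context regular_closed_representation
begin

lemma d_regular: "a \<in> carrier L \<Longrightarrow> d a \<in> regular_closed_sets X"
  using bij bij_betwE by blast

lemmas d_subset = regular_subset[OF d_regular]
lemmas d_closed = closedin_regular[OF d_regular]
lemmas closure_interior_d = closure_interior_regular[OF d_regular]

lemma d_surj:
  assumes "K \<in> regular_closed_sets X"
  obtains a where "a \<in> carrier L" "d a = K"
  using assms bij bij_betw_imp_surj_on by (metis imageE)

lemma d_inject: "\<lbrakk>a \<in> carrier L; b \<in> carrier L; d a = d b\<rbrakk> \<Longrightarrow> a = b"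
  using bij unfolding bij_betw_def inj_on_def by blast

lemma partial_order_L: "partial_order L"
  by unfold_locales (auto simp: eq_L le_iff intro: d_inject)

lemma regular_sup_exists:
  assumes A: "A \<subseteq> carrier L"
  shows "\<exists>s. s \<in> carrier L \<and> d s = X closure_of (\<Union>a \<in> A. X interior_of (d a)) \<and> least L s (Upper L A)"
proof -
  have "openin X (\<Union>a \<in> A. X interior_of (d a))" by (auto intro: openin_Union)
  then obtain s where s: "s \<in> carrier L" "d s = X closure_of (\<Union>a \<in> A. X interior_of (d a))"
    using d_surj regular_closed_closure by metis
  have "least L s (Upper L A)"
  proof (rule least_UpperI[OF _ _ A s(1)])
    fix a assume a: "a \<in> A"
    then have ac: "a \<in> carrier L" using A by blast
    have "d a \<subseteq> d s"
      unfolding s(2) using closure_interior_d[OF ac] a by (metis UN_upper closure_of_mono)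
    then show "a \<sqsubseteq> s" using le_iff ac s(1) by simp
  next
    fix u assume "u \<in> Upper L A"
    then have u: "u \<in> carrier L" "\<And>a. a \<in> A \<Longrightarrow> d a \<subseteq> d u"
      using A le_iff unfolding Upper_def by blast+
    have "X closure_of (\<Union>a \<in> A. X interior_of (d a)) \<subseteq> d u"
      by (rule closure_of_minimal[OF _ d_closed[OF u(1)]])
        (use u(2) interior_of_subset[of X] in blast)
    then show "s \<sqsubseteq> u" using le_iff s u(1) by simp
  qed
  with s show ?thesis by blast
qed

lemma regular_inf_exists:
  assumes A: "A \<subseteq> carrier L"
  shows "\<exists>s. s \<in> carrier L \<and> d s = X closure_of (X interior_of (topspace X \<inter> (\<Inter>a \<in> A. d a))) \<and>
    greatest L s (Lower L A)"
proof -
  obtain s where s: "s \<in> carrier L" "d s = X closure_of (X interior_of (topspace X \<inter> (\<Inter>a \<in> A. d a)))"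
    using d_surj regular_closed_closure[OF openin_interior_of] by metis
  have "greatest L s (Lower L A)"
  proof (rule greatest_LowerI[OF _ _ A s(1)])
    fix a assume a: "a \<in> A"
    then have ac: "a \<in> carrier L" using A by blast
    have "d s \<subseteq> d a"
      unfolding s(2) by (rule closure_of_minimal[OF _ d_closed[OF ac]])
        (use interior_of_subset[of X "topspace X \<inter> (\<Inter>a \<in> A. d a)"] a in blast)
    then show "s \<sqsubseteq> a" using le_iff ac s(1) by simp
  next
    fix u assume "u \<in> Lower L A"
    then have u: "u \<in> carrier L" "\<And>a. a \<in> A \<Longrightarrow> d u \<subseteq> d a"
      using A le_iff unfolding Lower_def by blast+
    have "X interior_of (d u) \<subseteq> X interior_of (topspace X \<inter> (\<Inter>a \<in> A. d a))"
      using u(2) d_subset[OF u(1)] by (intro interior_of_mono) blast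
    then have "d u \<subseteq> d s"
      unfolding s(2) using closure_interior_d[OF u(1)] closure_of_mono by metis
    then show "u \<sqsubseteq> s" using le_iff s u(1) by simp
  qed
  with s show ?thesis by blast
qed

lemma complete_lattice_L: "complete_lattice L"
proof -
  interpret partial_order L by (rule partial_order_L)
  show ?thesis
    by unfold_locales (use regular_sup_exists regular_inf_exists in blast)+
qed

sublocale complete_lattice L by (rule complete_lattice_L)

lemma d_sup:
  assumes A: "A \<subseteq> carrier L"
  shows "d (\<Squnion>A) = X closure_of (\<Union>a \<in> A. X interior_of (d a))"
proof -
  obtain s where s: "s \<in> carrier L" "d s = X closure_of (\<Union>a \<in> A. X interior_of (d a))"
    "least L s (Upper L A)" using regular_sup_exists[OF A] by blast
  have "\<Squnion>A = s" using least_unique[OF sup_lub[OF A] s(3)] .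
  with s show ?thesis by simp
qed

lemma d_inf:
  assumes A: "A \<subseteq> carrier L"
  shows "d (\<Sqinter>A) = X closure_of (X interior_of (topspace X \<inter> (\<Inter>a \<in> A. d a)))"
proof -
  obtain s where s: "s \<in> carrier L" "d s = X closure_of (X interior_of (topspace X \<inter> (\<Inter>a \<in> A. d a)))"
    "greatest L s (Lower L A)" using regular_inf_exists[OF A] by blast
  have "\<Sqinter>A = s" using greatest_unique[OF inf_glb[OF A] s(3)] .
  with s show ?thesis by simp
qed

lemma d_bottom: "d \<bottom> = {}"
proof -
  obtain z where z: "z \<in> carrier L" "d z = {}"
    using d_surj[of "{}"] unfolding regular_closed_sets_def by auto
  then have "\<bottom> \<sqsubseteq> z" by simp
  then show ?thesis using z le_iff[of \<bottom> z] by simp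
qed

lemma d_top: "d \<top> = topspace X"
proof -
  obtain z where z: "z \<in> carrier L" "d z = topspace X"
    using d_surj[of "topspace X"] unfolding regular_closed_sets_def by auto
  then have "z \<sqsubseteq> \<top>" by simp
  then show ?thesis using z le_iff[of z \<top>] d_subset[of \<top>] by auto
qed

lemma d_join: "\<lbrakk>a \<in> carrier L; b \<in> carrier L\<rbrakk> \<Longrightarrow> d (a \<squnion> b) = d a \<union> d b"
  unfolding join_def using closure_interior_d[of a] closure_interior_d[of b] by (subst d_sup) simp_all

lemma d_meet:
  assumes "a \<in> carrier L" "b \<in> carrier L"
  shows "d (a \<sqinter> b) = X closure_of (X interior_of (d a) \<inter> X interior_of (d b))"
proof -
  have "topspace X \<inter> (d a \<inter> d b) = d a \<inter> d b" using d_subset[OF assms(1)] by blast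
  then show ?thesis
    unfolding meet_def using assms by (subst d_inf) (simp_all add: interior_of_Int)
qed

lemma interior_d_meet:
  assumes "a \<in> carrier L" "b \<in> carrier L"
  shows "X interior_of (d (a \<sqinter> b)) = X interior_of (d a) \<inter> X interior_of (d b)"
proof (rule subset_antisym)
  have "d (a \<sqinter> b) \<subseteq> d a" "d (a \<sqinter> b) \<subseteq> d b"
    using le_iff[of "a \<sqinter> b" a] le_iff[of "a \<sqinter> b" b] assms by (simp_all add: meet_left meet_right)
  then show "X interior_of (d (a \<sqinter> b)) \<subseteq> X interior_of (d a) \<inter> X interior_of (d b)"
    by (simp add: interior_of_mono)
  show "X interior_of (d a) \<inter> X interior_of (d b) \<subseteq> X interior_of (d (a \<sqinter> b))"
    unfolding d_meet[OF assms]
    by (rule interior_of_maximal[OF closure_of_subset]) (auto simp: interior_of_subset_topspace openin_Int le_infI1)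
qed

lemma complement_witness:
  assumes x: "x \<in> carrier L"
  obtains y where "y \<in> carrier L" "x \<squnion> y = \<top>" "x \<sqinter> y = \<bottom>"
    "d y = topspace X - X interior_of (d x)"
proof -
  obtain y where y: "y \<in> carrier L" "d y = topspace X - X interior_of (d x)"
    using d_surj[OF regular_complement(1)[OF d_regular[OF x]]] by metis
  have "x \<squnion> y = \<top>"
    using x y d_subset[OF x] interior_of_subset[of X "d x"]
    by (intro d_inject) (auto simp: d_join d_top)
  moreover have "x \<sqinter> y = \<bottom>"
    using x y regular_complement(2)[OF d_regular[OF x]] interior_of_subset[of X "d x"]
    by (intro d_inject) (auto simp: d_meet d_bottom closure_of_eq_empty_gen disjnt_iff)
  ultimately show thesis using that y by blast
qed

lemma boolean_lattice_L: "boolean_lattice L"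
proof
  fix x y z assume car: "x \<in> carrier L" "y \<in> carrier L" "z \<in> carrier L"
  let ?i = "\<lambda>a. X interior_of (d a)"
  have "d (x \<sqinter> (y \<squnion> z)) = X closure_of (?i x \<inter> X interior_of (d y \<union> d z))"
    using car by (simp add: d_meet d_join)
  also have "\<dots> = X closure_of (?i x \<inter> (?i y \<union> ?i z))"
  proof (rule subset_antisym)
    have "X closure_of (?i x \<inter> X interior_of (d y \<union> d z)) \<subseteq> X closure_of (?i x \<inter> (d y \<union> d z))"
      using interior_of_subset[of X "d y \<union> d z"] by (intro closure_of_mono) blast
    also have "\<dots> = X closure_of (?i x \<inter> X closure_of (?i y \<union> ?i z))"
      using car by (simp add: closure_interior_d)
    also have "\<dots> = X closure_of (?i x \<inter> (?i y \<union> ?i z))"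
      by (rule closure_of_openin_Int_closure_of) simp
    finally show "X closure_of (?i x \<inter> X interior_of (d y \<union> d z)) \<subseteq> X closure_of (?i x \<inter> (?i y \<union> ?i z))" .
    show "X closure_of (?i x \<inter> (?i y \<union> ?i z)) \<subseteq> X closure_of (?i x \<inter> X interior_of (d y \<union> d z))"
      using interior_of_mono[of "d y" "d y \<union> d z" X] interior_of_mono[of "d z" "d y \<union> d z" X]
      by (intro closure_of_mono) blast
  qed
  also have "\<dots> = d ((x \<sqinter> y) \<squnion> (x \<sqinter> z))"
    using car by (simp add: d_meet d_join Int_Un_distrib)
  finally show "x \<sqinter> (y \<squnion> z) = (x \<sqinter> y) \<squnion> (x \<sqinter> z)"
    using car by (intro d_inject) auto
next
  show "\<exists>y \<in> carrier L. x \<squnion> y = \<top> \<and> x \<sqinter> y = \<bottom>" if "x \<in> carrier L" for x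
    using complement_witness[OF that] by metis
qed

sublocale boolean_lattice L by (rule boolean_lattice_L)

lemma d_complement:
  assumes x: "x \<in> carrier L"
  shows "d (\<sim>x) = topspace X - X interior_of (d x)"
  by (rule complement_witness[OF x]) (use complement_eqI[OF x] in blast)

lemma interior_d_complement:
  "x \<in> carrier L \<Longrightarrow> X interior_of (d (\<sim>x)) = topspace X - d x"
  by (simp add: d_complement regular_complement(2) d_regular)

lemma well_inside_iff:
  assumes "a \<in> carrier L" "b \<in> carrier L"
  shows "a \<lless> b \<longleftrightarrow> d a \<subseteq> X interior_of (d b)"
  using assms contact_iff[of a "\<sim>b"] d_subset[of a] unfolding well_inside_def by (auto simp: d_complement)

end

locale locally_compact_representation = regular_closed_representation +
  assumes locally_compact: "locally_compact_space X" and Hausdorff: "Hausdorff_space X"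
begin

lemma neighbourhood:
  assumes "compactin X C" "openin X U" "C \<subseteq> U"
  obtains a where "a \<in> bounded_elems L" "a \<in> carrier L" "C \<subseteq> X interior_of (d a)" "d a \<subseteq> U"
  using compact_regular_neighbourhood[OF locally_compact Hausdorff assms] d_surj bounded_eq
  by (metis (mono_tags, lifting) mem_Collect_eq)

lemma point_neighbourhood:
  assumes "openin X U" "x \<in> U"
  obtains a where "a \<in> bounded_elems L" "a \<in> carrier L" "x \<in> X interior_of (d a)" "d a \<subseteq> U"
  using neighbourhood[of "{x}" U] assms openin_subset[OF assms(1)] by auto

lemma local_contact_algebra_L: "local_contact_algebra L"
proof
  fix a assume a: "a \<in> carrier L" "a \<noteq> \<bottom>"
  then have "d a \<noteq> {}" using d_inject[of a \<bottom>] d_bottom by auto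
  then show "a \<bowtie> a" using contact_iff a(1) by simp
  have "X interior_of (d a) \<noteq> {}"
    using \<open>d a \<noteq> {}\<close> closure_interior_d[OF a(1)] by auto
  then obtain x where "x \<in> X interior_of (d a)" by blast
  then obtain b where b: "b \<in> bounded_elems L" "b \<in> carrier L" "x \<in> X interior_of (d b)"
    "d b \<subseteq> X interior_of (d a)"
    using point_neighbourhood[OF openin_interior_of] by metis
  moreover have "b \<noteq> \<bottom>" using b(3) d_bottom by auto
  ultimately show "\<exists>b \<in> bounded_elems L - {\<bottom>}. b \<lless> a" using well_inside_iff a(1) by blast
next
  show "lattice_ideal L (bounded_elems L)"
    unfolding lattice_ideal_def bounded_eq
  proof (intro conjI ballI impI)
    show "{a \<in> carrier L. compactin X (d a)} \<noteq> {}" using d_bottom by auto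
    show "y \<in> {a \<in> carrier L. compactin X (d a)}"
      if "x \<in> {a \<in> carrier L. compactin X (d a)}" "y \<in> carrier L" "y \<sqsubseteq> x" for x y
      using that closed_compactin[of X "d x" "d y"] d_closed le_iff by simp
  qed (auto simp: d_join compactin_Un)
next
  fix a c assume a: "a \<in> bounded_elems L" and c: "c \<in> carrier L" and ac: "a \<lless> c"
  have acar: "a \<in> carrier L" and comp: "compactin X (d a)" using a bounded_eq by auto
  have "d a \<subseteq> X interior_of (d c)" using ac well_inside_iff acar c by simp
  then obtain b where "b \<in> bounded_elems L" "b \<in> carrier L" "d a \<subseteq> X interior_of (d b)"
    "d b \<subseteq> X interior_of (d c)"
    using neighbourhood[OF comp openin_interior_of] by metis
  then show "\<exists>b \<in> bounded_elems L. a \<lless> b \<and> b \<lless> c" using well_inside_iff acar c by blast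
next
  fix a b assume ab: "a \<in> carrier L" "b \<in> carrier L" "a \<bowtie> b"
  then obtain x where x: "x \<in> d a" "x \<in> d b" using contact_iff by blast
  then obtain c where c: "c \<in> bounded_elems L" "c \<in> carrier L" "x \<in> X interior_of (d c)"
    using point_neighbourhood[OF openin_topspace] d_subset[OF ab(1)] by (metis subsetD)
  have "x \<in> d (c \<sqinter> b)"
    unfolding d_meet[OF c(2) ab(2)]
    using openin_Int_closure_of_subset[OF openin_interior_of, of X "d c" "X interior_of (d b)"]
      closure_interior_d[OF ab(2)] x(2) c(3) by auto
  then show "\<exists>c \<in> bounded_elems L. a \<bowtie> c \<sqinter> b"
    using c x(1) contact_iff[of a "c \<sqinter> b"] ab by auto
qed (auto simp: contact_iff d_bottom d_join)

lemma complete_local_contact_algebra_L: "complete_local_contact_algebra L"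
  using local_contact_algebra_L complete_lattice_L by (rule complete_local_contact_algebra.intro)

sublocale complete_local_contact_algebra L by (rule complete_local_contact_algebra_L)

end

section \<open>Skeletal maps\<close>

abbreviation preimage_in :: "'a topology \<Rightarrow> ('a \<Rightarrow> 'b) \<Rightarrow> 'b set \<Rightarrow> 'a set" where
  "preimage_in X f S \<equiv> {x \<in> topspace X. f x \<in> S}"

lemma skeletal_mapD:
  assumes "skeletal_map X Y f" "openin Y V"
  shows "X interior_of (preimage_in X f (Y closure_of V)) \<subseteq> X closure_of (preimage_in X f V)"
  using assms unfolding skeletal_map_def by blast

lemma skeletal_map_id: "skeletal_map X X (\<lambda>x \<in> topspace X. x)"
  unfolding skeletal_map_def
proof (intro conjI allI impI)
  fix V assume V: "openin X V"
  have "{x \<in> topspace X. (\<lambda>x \<in> topspace X. x) x \<in> S} = topspace X \<inter> S" for S by auto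
  moreover have "X interior_of (topspace X \<inter> X closure_of V) \<subseteq> X closure_of V"
    using interior_of_subset by fastforce
  ultimately show "X interior_of {x \<in> topspace X. (\<lambda>x \<in> topspace X. x) x \<in> X closure_of V}
      \<subseteq> X closure_of {x \<in> topspace X. (\<lambda>x \<in> topspace X. x) x \<in> V}"
    using closure_of_restrict[of X V] by simp
qed simp

text \<open>The complement \<open>V\<close> of the boundary of \<open>C\<close> is open and dense, so by skeletality its preimage is
  dense. Inside the preimage of \<open>C\<close>, this dense set lies over the interior of \<open>C\<close>.\<close>

lemma skeletal_closedin:
  assumes f: "skeletal_map X Y f" and C: "closedin Y C"
  shows "X interior_of (preimage_in X f C) \<subseteq> X closure_of (preimage_in X f (Y interior_of C))"
proof -
  let ?V = "Y interior_of C \<union> (topspace Y - C)" and ?O = "X interior_of (preimage_in X f C)"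
  have "Y closure_of ?V \<supseteq> topspace Y"
    using closure_of_subset[OF interior_of_subset_topspace[of Y C]]
    by (auto simp: closure_of_complement)
  then have "preimage_in X f (Y closure_of ?V) = topspace X"
    using f unfolding skeletal_map_def by blast
  moreover have "openin Y ?V" using C by (simp add: openin_Un openin_diff)
  ultimately have "topspace X \<subseteq> X closure_of (preimage_in X f ?V)"
    using skeletal_mapD[OF f] by fastforce
  then have "?O \<subseteq> ?O \<inter> X closure_of (preimage_in X f ?V)"
    using interior_of_subset_topspace[of X] by blast
  also have "\<dots> \<subseteq> X closure_of (?O \<inter> preimage_in X f ?V)"
    by (simp add: openin_Int_closure_of_subset)
  also have "\<dots> \<subseteq> X closure_of (preimage_in X f (Y interior_of C))"
    using interior_of_subset[of X "preimage_in X f C"] by (intro closure_of_mono) auto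
  finally show ?thesis .
qed

text \<open>For skeletal maps, taking preimages commutes with regularising an open set, up to closure.
  Preservation of joins and functoriality both reduce to this.\<close>

lemma closure_preimage_closure:
  assumes f: "continuous_map X Y f" "skeletal_map X Y f" and V: "openin Y V"
  shows "X closure_of (preimage_in X f (Y interior_of (Y closure_of V)))
    = X closure_of (preimage_in X f V)"
proof (rule subset_antisym)
  have "openin X (preimage_in X f (Y interior_of (Y closure_of V)))"
    using openin_continuous_map_preimage[OF f(1)] by simp
  then have "preimage_in X f (Y interior_of (Y closure_of V))
      \<subseteq> X interior_of (preimage_in X f (Y closure_of V))"
    using interior_of_subset[of Y] by (intro interior_of_maximal) blast
  also have "\<dots> \<subseteq> X closure_of (preimage_in X f V)" by (rule skeletal_mapD[OF f(2) V])
  finally show "X closure_of (preimage_in X f (Y interior_of (Y closure_of V)))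
    \<subseteq> X closure_of (preimage_in X f V)"
    by (rule closure_of_minimal) simp
  show "X closure_of (preimage_in X f V)
      \<subseteq> X closure_of (preimage_in X f (Y interior_of (Y closure_of V)))"
    using interior_of_maximal[OF closure_of_subset[OF openin_subset[OF V]] V]
    by (intro closure_of_mono) blast
qed

lemma skeletal_map_compose:
  assumes f: "continuous_map X Y f" "skeletal_map X Y f"
    and g: "continuous_map Y Z g" "skeletal_map Y Z g"
  shows "skeletal_map X Z (compose (topspace X) g f)"
  unfolding skeletal_map_def
proof (intro conjI allI impI)
  have fY: "f x \<in> topspace Y" if "x \<in> topspace X" for x
    using f(2) that unfolding skeletal_map_def by blast
  then show "compose (topspace X) g f \<in> topspace X \<rightarrow> topspace Z"
    using g(2) unfolding skeletal_map_def by (auto simp: compose_eq)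
  have pre: "{x \<in> topspace X. compose (topspace X) g f x \<in> S} = preimage_in X f (preimage_in Y g S)" for S
    using fY by (auto simp: compose_eq)
  fix V assume V: "openin Z V"
  let ?C = "preimage_in Y g (Z closure_of V)" and ?W = "preimage_in Y g V"
  have W: "openin Y ?W" by (rule openin_continuous_map_preimage[OF g(1) V])
  have C: "closedin Y ?C" by (rule closedin_continuous_map_preimage[OF g(1)]) simp
  have "X interior_of (preimage_in X f ?C) \<subseteq> X closure_of (preimage_in X f (Y interior_of ?C))"
    by (rule skeletal_closedin[OF f(2) C])
  also have "\<dots> \<subseteq> X closure_of (preimage_in X f (Y interior_of (Y closure_of ?W)))"
  proof -
    have "Y interior_of ?C \<subseteq> Y interior_of (Y closure_of ?W)"
      by (rule interior_of_maximal[OF skeletal_mapD[OF g(2) V]]) simp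
    then show ?thesis by (intro closure_of_mono) blast
  qed
  also have "\<dots> = X closure_of (preimage_in X f ?W)" by (rule closure_preimage_closure[OF f W])
  finally show "X interior_of {x \<in> topspace X. compose (topspace X) g f x \<in> Z closure_of V}
      \<subseteq> X closure_of {x \<in> topspace X. compose (topspace X) g f x \<in> V}"
    unfolding pre .
qed

section \<open>Complete homomorphisms and their left adjoints\<close>

lemma left_adjoint_eqI:
  assumes "partial_order A" "c \<in> carrier A"
    "\<And>a. a \<in> carrier A \<Longrightarrow> b \<sqsubseteq>\<^bsub>B\<^esub> \<phi> a \<longleftrightarrow> c \<sqsubseteq>\<^bsub>A\<^esub> a"
  shows "left_adjoint A B \<phi> b = c"
  unfolding left_adjoint_def
proof (rule the_equality)
  interpret partial_order A by fact
  show "c \<in> carrier A \<and> (\<forall>a \<in> carrier A. b \<sqsubseteq>\<^bsub>B\<^esub> \<phi> a \<longleftrightarrow> c \<sqsubseteq>\<^bsub>A\<^esub> a)"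
    using assms(2,3) by blast
  fix c' assume "c' \<in> carrier A \<and> (\<forall>a \<in> carrier A. b \<sqsubseteq>\<^bsub>B\<^esub> \<phi> a \<longleftrightarrow> c' \<sqsubseteq>\<^bsub>A\<^esub> a)"
  then show "c' = c" using assms(2,3) le_antisym[of c' c] le_refl by metis
qed

lemma
  assumes A: "complete_lattice A" and B: "complete_lattice B"
    and \<phi>: "\<phi> \<in> carrier A \<rightarrow> carrier B" "inf_pres A B \<phi>" and b: "b \<in> carrier B"
  shows left_adjoint_closed: "left_adjoint A B \<phi> b \<in> carrier A"
    and left_adjoint: "a \<in> carrier A \<Longrightarrow> b \<sqsubseteq>\<^bsub>B\<^esub> \<phi> a \<longleftrightarrow> left_adjoint A B \<phi> b \<sqsubseteq>\<^bsub>A\<^esub> a"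
proof -
  interpret A: complete_lattice A by fact
  interpret B: complete_lattice B by fact
  let ?S = "{a \<in> carrier A. b \<sqsubseteq>\<^bsub>B\<^esub> \<phi> a}"
  let ?c = "\<Sqinter>\<^bsub>A\<^esub>?S"
  have S: "?S \<subseteq> carrier A" by blast
  have c: "?c \<in> carrier A" using A.inf_closed[OF S] .
  have "b \<sqsubseteq>\<^bsub>B\<^esub> \<Sqinter>\<^bsub>B\<^esub>(\<phi> ` ?S)"
    by (rule B.inf_greatest) (use \<phi>(1) b in auto)
  also have "\<Sqinter>\<^bsub>B\<^esub>(\<phi> ` ?S) = \<phi> ?c"
    using \<phi>(2) S unfolding inf_pres_def by simp
  finally have bc: "b \<sqsubseteq>\<^bsub>B\<^esub> \<phi> ?c" .
  have mono: "\<phi> x \<sqsubseteq>\<^bsub>B\<^esub> \<phi> y" if xy: "x \<in> carrier A" "y \<in> carrier A" "x \<sqsubseteq>\<^bsub>A\<^esub> y" for x y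
  proof -
    have "x = \<Sqinter>\<^bsub>A\<^esub>{x, y}"
      using A.le_iff_join[OF xy(1,2)] xy(3) unfolding meet_def by simp
    then have "\<phi> x = \<Sqinter>\<^bsub>B\<^esub>(\<phi> ` {x, y})"
      using \<phi>(2) xy unfolding inf_pres_def by (metis empty_subsetI insert_subset)
    also have "\<dots> \<sqsubseteq>\<^bsub>B\<^esub> \<phi> y" by (rule B.inf_lower) (use \<phi>(1) xy in auto)
    finally show ?thesis .
  qed
  have adj: "b \<sqsubseteq>\<^bsub>B\<^esub> \<phi> a \<longleftrightarrow> ?c \<sqsubseteq>\<^bsub>A\<^esub> a" if a: "a \<in> carrier A" for a
  proof
    show "?c \<sqsubseteq>\<^bsub>A\<^esub> a" if "b \<sqsubseteq>\<^bsub>B\<^esub> \<phi> a" by (rule A.inf_lower[OF S]) (use a that in simp)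
    show "b \<sqsubseteq>\<^bsub>B\<^esub> \<phi> a" if "?c \<sqsubseteq>\<^bsub>A\<^esub> a"
      using B.le_trans[OF bc mono[OF c a that] b] \<phi>(1) c a by blast
  qed
  have "left_adjoint A B \<phi> b = ?c"
    by (rule left_adjoint_eqI[OF A.partial_order_axioms c adj])
  then show "left_adjoint A B \<phi> b \<in> carrier A"
    and "a \<in> carrier A \<Longrightarrow> b \<sqsubseteq>\<^bsub>B\<^esub> \<phi> a \<longleftrightarrow> left_adjoint A B \<phi> b \<sqsubseteq>\<^bsub>A\<^esub> a"
    using c adj by simp_all
qed

lemma (in complete_local_contact_algebra) complement_inf:
  assumes A: "A \<subseteq> carrier L"
  shows "\<Sqinter>A = \<sim>(\<Squnion>(complement L ` A))"
proof (rule le_antisym)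
  have c: "complement L ` A \<subseteq> carrier L" using A by auto
  have "\<Squnion>(complement L ` A) \<sqsubseteq> \<sim>(\<Sqinter>A)"
  proof (rule sup_least[OF c])
    fix x assume "x \<in> complement L ` A"
    then obtain a where a: "a \<in> A" "x = \<sim>a" by blast
    then show "x \<sqsubseteq> \<sim>(\<Sqinter>A)"
      using inf_lower[OF A a(1)] subsetD[OF A a(1)] inf_closed[OF A] by simp
  qed (use inf_closed[OF A] in simp)
  then show "\<Sqinter>A \<sqsubseteq> \<sim>(\<Squnion>(complement L ` A))"
    using complement_le_iff[of "\<sim>(\<Sqinter>A)" "\<Squnion>(complement L ` A)"] inf_closed[OF A] sup_closed[OF c] by simp
  show "\<sim>(\<Squnion>(complement L ` A)) \<sqsubseteq> \<Sqinter>A"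
  proof (rule inf_greatest[OF A])
    fix a assume a: "a \<in> A"
    then have "\<sim>a \<sqsubseteq> \<Squnion>(complement L ` A)" by (intro sup_upper[OF c]) simp
    then show "\<sim>(\<Squnion>(complement L ` A)) \<sqsubseteq> a"
      using complement_le_iff[of "\<Squnion>(complement L ` A)" "\<sim>a"] subsetD[OF A a] sup_closed[OF c]
      by simp
  qed (use sup_closed[OF c] in simp)
  show "\<Sqinter>A \<in> carrier L" by (rule inf_closed[OF A])
  show "\<sim>(\<Squnion>(complement L ` A)) \<in> carrier L" using sup_closed[OF c] by simp
qed

text \<open>The morphisms of \<^const>\<open>DSkeLC\<close>, for algebras on arbitrary types.\<close>

definition contact_hom ::
  "('a, 'm) local_contact_lattice_scheme \<Rightarrow> ('b, 'n) local_contact_lattice_scheme \<Rightarrow> ('a \<Rightarrow> 'b) \<Rightarrow> bool"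
  where
  "contact_hom A B \<phi> \<longleftrightarrow> \<phi> \<in> extensional (carrier A) \<and> complete_boolean_hom A B \<phi> \<and>
     (\<forall>a \<in> carrier A. \<forall>b \<in> carrier A. contact B (\<phi> a) (\<phi> b) \<longrightarrow> contact A a b) \<and>
     (\<forall>b \<in> bounded_elems B. left_adjoint A B \<phi> b \<in> bounded_elems A)"

section \<open>The dual of a skeletal map\<close>

definition dual_map ::
  "'a topology \<Rightarrow> ('b, 'm) local_contact_lattice_scheme \<Rightarrow> ('b \<Rightarrow> 'a set) \<Rightarrow>
   'c topology \<Rightarrow> ('e, 'n) local_contact_lattice_scheme \<Rightarrow> ('e \<Rightarrow> 'c set) \<Rightarrow> ('a \<Rightarrow> 'c) \<Rightarrow> 'e \<Rightarrow> 'b" where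
  "dual_map X L d Y M e f =
     (\<lambda>a \<in> carrier M. inv_into (carrier L) d (X closure_of (preimage_in X f (Y interior_of (e a)))))"

locale representation_pair =
  X: locally_compact_representation X L d + Y: locally_compact_representation Y M e
  for X :: "'a topology" and L :: "('b, 'm) local_contact_lattice_scheme" and d
    and Y :: "'c topology" and M :: "('e, 'n) local_contact_lattice_scheme" and e
begin

abbreviation dual :: "('a \<Rightarrow> 'c) \<Rightarrow> 'e \<Rightarrow> 'b" where
  "dual \<equiv> dual_map X L d Y M e"

lemma
  assumes f: "continuous_map X Y f" and a: "a \<in> carrier M"
  shows dual_closed: "dual f a \<in> carrier L"
    and d_dual: "d (dual f a) = X closure_of (preimage_in X f (Y interior_of (e a)))"
proof -
  have "X closure_of (preimage_in X f (Y interior_of (e a))) \<in> regular_closed_sets X"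
    using openin_continuous_map_preimage[OF f] by (intro regular_closed_closure) simp
  then have "X closure_of (preimage_in X f (Y interior_of (e a))) \<in> d ` carrier L"
    using bij_betw_imp_surj_on[OF X.bij] by simp
  then show "dual f a \<in> carrier L"
    "d (dual f a) = X closure_of (preimage_in X f (Y interior_of (e a)))"
    unfolding dual_map_def using a by (simp_all add: inv_into_into f_inv_into_f)
qed

lemma d_dual_subset:
  assumes "continuous_map X Y f" "a \<in> carrier M"
  shows "d (dual f a) \<subseteq> preimage_in X f (e a)"
  unfolding d_dual[OF assms]
  by (rule closure_of_minimal)
    (use interior_of_subset[of Y] closedin_continuous_map_preimage[OF assms(1) Y.d_closed[OF assms(2)]]
      in auto)

lemma dual_eqI:
  assumes "\<phi> \<in> extensional (carrier M)" "continuous_map X Y f"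
    and "\<And>a. a \<in> carrier M \<Longrightarrow> \<phi> a \<in> carrier L"
    and "\<And>a. a \<in> carrier M \<Longrightarrow> d (\<phi> a) = X closure_of (preimage_in X f (Y interior_of (e a)))"
  shows "dual f = \<phi>"
proof (rule extensionalityI[where A = "carrier M"])
  show "dual f \<in> extensional (carrier M)" unfolding dual_map_def by simp
  show "dual f a = \<phi> a" if "a \<in> carrier M" for a
    using that assms by (intro X.d_inject) (simp_all add: dual_closed d_dual)
qed fact

context
  fixes f
  assumes f: "continuous_map X Y f" "skeletal_map X Y f"
begin

text \<open>By skeletality, the interior of the dual is computed from the closed set instead of its
  interior; this exchanges the two descriptions when passing to complements.\<close>

lemma interior_d_dual:
  assumes a: "a \<in> carrier M"
  shows "X interior_of (d (dual f a)) = X interior_of (preimage_in X f (e a))"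
proof (rule subset_antisym)
  show "X interior_of (d (dual f a)) \<subseteq> X interior_of (preimage_in X f (e a))"
    by (rule interior_of_mono[OF d_dual_subset[OF f(1) a]])
  have "X interior_of (preimage_in X f (e a)) \<subseteq> d (dual f a)"
    using skeletal_closedin[OF f(2) Y.d_closed[OF a]] unfolding d_dual[OF f(1) a] .
  then show "X interior_of (preimage_in X f (e a)) \<subseteq> X interior_of (d (dual f a))"
    by (simp add: interior_of_maximal)
qed

lemma dual_sup:
  assumes A: "A \<subseteq> carrier M"
  shows "dual f (\<Squnion>\<^bsub>M\<^esub>A) = \<Squnion>\<^bsub>L\<^esub>(dual f ` A)"
proof -
  have im: "dual f ` A \<subseteq> carrier L" using A dual_closed[OF f(1)] by blast
  let ?V = "\<Union>a \<in> A. Y interior_of (e a)"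
  have V: "openin Y ?V" by (auto intro: openin_Union)
  have "d (dual f (\<Squnion>\<^bsub>M\<^esub>A)) = X closure_of (preimage_in X f ?V)"
    using A closure_preimage_closure[OF f V] by (simp add: d_dual[OF f(1)] Y.d_sup)
  also have "\<dots> = X closure_of (\<Union>b \<in> dual f ` A. X interior_of (d b))"
  proof (rule subset_antisym)
    have "preimage_in X f (Y interior_of (e a)) \<subseteq> X interior_of (d (dual f a))" if "a \<in> A" for a
      unfolding d_dual[OF f(1) subsetD[OF A that]]
      using openin_continuous_map_preimage[OF f(1)]
      by (intro interior_of_maximal closure_of_subset) auto
    then show "X closure_of (preimage_in X f ?V) \<subseteq> X closure_of (\<Union>b \<in> dual f ` A. X interior_of (d b))"
      by (intro closure_of_mono) blast
    have "X interior_of (d (dual f a)) \<subseteq> X closure_of (preimage_in X f ?V)" if "a \<in> A" for a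
    proof -
      have "d (dual f a) \<subseteq> X closure_of (preimage_in X f ?V)"
        unfolding d_dual[OF f(1) subsetD[OF A that]] using that by (intro closure_of_mono) blast
      then show ?thesis using interior_of_subset[of X] by blast
    qed
    then show "X closure_of (\<Union>b \<in> dual f ` A. X interior_of (d b)) \<subseteq> X closure_of (preimage_in X f ?V)"
      by (intro closure_of_minimal) auto
  qed
  also have "\<dots> = d (\<Squnion>\<^bsub>L\<^esub>(dual f ` A))" using im by (simp add: X.d_sup)
  finally show ?thesis
    using im A dual_closed[OF f(1)] by (intro X.d_inject) simp_all
qed

lemma dual_complement:
  assumes a: "a \<in> carrier M"
  shows "dual f (complement M a) = complement L (dual f a)"
proof (rule X.d_inject)
  have fY: "f x \<in> topspace Y" if "x \<in> topspace X" for x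
    using f(2) that unfolding skeletal_map_def by blast
  have "d (dual f (complement M a)) = X closure_of (preimage_in X f (topspace Y - e a))"
    using a by (simp add: d_dual[OF f(1)] Y.interior_d_complement)
  also have "preimage_in X f (topspace Y - e a) = topspace X - preimage_in X f (e a)"
    using fY by blast
  also have "X closure_of \<dots> = topspace X - X interior_of (d (dual f a))"
    unfolding closure_of_complement interior_d_dual[OF a] ..
  finally show "d (dual f (complement M a)) = d (complement L (dual f a))"
    using a by (simp add: X.d_complement dual_closed[OF f(1)])
qed (use a dual_closed[OF f(1)] in simp_all)

lemma dual_inf:
  assumes A: "A \<subseteq> carrier M"
  shows "dual f (\<Sqinter>\<^bsub>M\<^esub>A) = \<Sqinter>\<^bsub>L\<^esub>(dual f ` A)"
proof -
  have im: "dual f ` A \<subseteq> carrier L" using A dual_closed[OF f(1)] by blast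
  have c: "complement M ` A \<subseteq> carrier M" using A by auto
  have "dual f ` complement M ` A = complement L ` dual f ` A"
    using A dual_complement by (auto simp: image_image intro!: image_cong)
  then show ?thesis
    using X.complement_inf[OF im] Y.complement_inf[OF A] dual_complement[OF Y.sup_closed[OF c]]
      dual_sup[OF c] by simp
qed

lemma dual_contact_hom: "contact_hom M L (dual f)"
  unfolding contact_hom_def
proof (intro conjI ballI impI)
  show "dual f \<in> extensional (carrier M)" unfolding dual_map_def by simp
  have maps: "dual f \<in> carrier M \<rightarrow> carrier L" using dual_closed[OF f(1)] by blast
  have inf: "inf_pres M L (dual f)"
    unfolding inf_pres_def using X.complete_lattice_L Y.complete_lattice_L dual_inf by simp
  then show "complete_boolean_hom M L (dual f)"
    unfolding complete_boolean_hom_def sup_pres_def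
    using X.complete_lattice_L Y.complete_lattice_L maps dual_sup dual_complement by simp
  show "contact M a b"
    if ab: "a \<in> carrier M" "b \<in> carrier M" "contact L (dual f a) (dual f b)" for a b
  proof -
    have "d (dual f a) \<inter> d (dual f b) \<noteq> {}"
      using ab X.contact_iff dual_closed[OF f(1)] by simp
    then show ?thesis
      using d_dual_subset[OF f(1) ab(1)] d_dual_subset[OF f(1) ab(2)] Y.contact_iff ab(1,2) by blast
  qed
  \<comment> \<open>The image of a compact set has a compact regular closed neighbourhood, which is above the
    left adjoint.\<close>
  fix b assume "b \<in> bounded_elems L"
  then have b: "b \<in> carrier L" "compactin X (d b)" unfolding X.bounded_eq by auto
  have "compactin Y (f ` d b)" using image_compactin[OF b(2) f(1)] .
  then obtain a where a: "a \<in> bounded_elems M" "a \<in> carrier M" "f ` d b \<subseteq> Y interior_of (e a)"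
    using Y.neighbourhood[OF _ openin_topspace] compactin_subset_topspace by metis
  have "d b \<subseteq> preimage_in X f (Y interior_of (e a))"
    using a(3) X.d_subset[OF b(1)] by blast
  also have "\<dots> \<subseteq> d (dual f a)"
    unfolding d_dual[OF f(1) a(2)] by (rule closure_of_subset) blast
  finally have "left_adjoint M L (dual f) b \<sqsubseteq>\<^bsub>M\<^esub> a"
    using left_adjoint[OF Y.complete_lattice_L X.complete_lattice_L maps inf b(1) a(2)]
      X.le_iff[OF b(1) dual_closed[OF f(1) a(2)]] by simp
  then show "left_adjoint M L (dual f) b \<in> bounded_elems M"
    using Y.bounded_down[OF a(1)]
      left_adjoint_closed[OF Y.complete_lattice_L X.complete_lattice_L maps inf b(1)] by simp
qed

end

text \<open>Two maps that differ at a point are told apart by a regular closed neighbourhood of one of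
  the two values.\<close>

lemma dual_inject:
  assumes f: "continuous_map X Y f" and g: "continuous_map X Y g" and eq: "dual f = dual g"
    and x: "x \<in> topspace X"
  shows "f x = g x"
proof (rule ccontr)
  assume "f x \<noteq> g x"
  moreover have "f x \<in> topspace Y" "g x \<in> topspace Y"
    using f g x continuous_map_image_subset_topspace by blast+
  ultimately obtain U V where UV: "openin Y U" "openin Y V" "f x \<in> U" "g x \<in> V" "disjnt U V"
    using Y.Hausdorff unfolding Hausdorff_space_def by metis
  obtain a where a: "a \<in> carrier M" "f x \<in> Y interior_of (e a)" "e a \<subseteq> U"
    using Y.point_neighbourhood[OF UV(1,3)] by metis
  have "x \<in> X closure_of (preimage_in X f (Y interior_of (e a)))"
    using closure_of_subset[of "preimage_in X f (Y interior_of (e a))" X] a(2) x by blast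
  then have "x \<in> d (dual g a)" using d_dual[OF f a(1)] eq by simp
  then have "g x \<in> e a" using d_dual_subset[OF g a(1)] by blast
  then show False using a(3) UV(4,5) by (auto simp: disjnt_iff)
qed

end

lemma dual_map_id:
  assumes "regular_closed_representation X L d"
  shows "dual_map X L d X L d (\<lambda>x \<in> topspace X. x) = (\<lambda>a \<in> carrier L. a)"
proof
  interpret regular_closed_representation X L d by fact
  fix a
  have "dual_map X L d X L d (\<lambda>x \<in> topspace X. x) a = a" if a: "a \<in> carrier L"
  proof -
    have "{x \<in> topspace X. (\<lambda>x \<in> topspace X. x) x \<in> X interior_of (d a)} = X interior_of (d a)"
      using interior_of_subset_topspace[of X "d a"] by auto
    then show ?thesis
      unfolding dual_map_def using a closure_interior_d[OF a] inv_into_f_f[OF bij_betw_imp_inj_on[OF bij] a]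
      by simp
  qed
  then show "dual_map X L d X L d (\<lambda>x \<in> topspace X. x) a = (\<lambda>a \<in> carrier L. a) a"
    by (simp add: dual_map_def)
qed

lemma dual_map_compose:
  assumes X: "locally_compact_representation X L d" and Y: "locally_compact_representation Y M e"
    and Z: "locally_compact_representation Z N k"
    and f: "continuous_map X Y f" "skeletal_map X Y f" and g: "continuous_map Y Z g" "skeletal_map Y Z g"
  shows "dual_map X L d Z N k (compose (topspace X) g f)
    = compose (carrier N) (dual_map X L d Y M e f) (dual_map Y M e Z N k g)"
proof -
  interpret XY: representation_pair X L d Y M e using X Y by (rule representation_pair.intro)
  interpret YZ: representation_pair Y M e Z N k using Y Z by (rule representation_pair.intro)
  interpret XZ: representation_pair X L d Z N k using X Z by (rule representation_pair.intro)
  have fY: "f x \<in> topspace Y" if "x \<in> topspace X" for x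
    using f(2) that unfolding skeletal_map_def by blast
  have gf: "continuous_map X Z (compose (topspace X) g f)"
    using continuous_map_compose[OF f(1) g(1)] by (rule continuous_map_eq) (simp add: compose_eq)
  show ?thesis
  proof (rule XZ.dual_eqI[OF _ gf])
    fix a assume a: "a \<in> carrier N"
    let ?V = "preimage_in Y g (Z interior_of (k a))"
    have b: "dual_map Y M e Z N k g a \<in> carrier M" by (rule YZ.dual_closed[OF g(1) a])
    have V: "openin Y ?V" using openin_continuous_map_preimage[OF g(1)] by simp
    show "compose (carrier N) (dual_map X L d Y M e f) (dual_map Y M e Z N k g) a \<in> carrier L"
      using a XY.dual_closed[OF f(1) b] by (simp add: compose_eq)
    have "d (dual_map X L d Y M e f (dual_map Y M e Z N k g a))
        = X closure_of (preimage_in X f (Y interior_of (Y closure_of ?V)))"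
      by (simp add: XY.d_dual[OF f(1) b] YZ.d_dual[OF g(1) a])
    also have "\<dots> = X closure_of (preimage_in X f ?V)" by (rule closure_preimage_closure[OF f V])
    also have "preimage_in X f ?V = preimage_in X (compose (topspace X) g f) (Z interior_of (k a))"
      using fY by (auto simp: compose_eq)
    finally show "d (compose (carrier N) (dual_map X L d Y M e f) (dual_map Y M e Z N k g) a)
        = X closure_of (preimage_in X (compose (topspace X) g f) (Z interior_of (k a)))"
      using a by (simp add: compose_eq)
  qed (simp add: compose_def)
qed

section \<open>Every homomorphism is the dual of a skeletal map\<close>

context representation_pair
begin

context
  fixes \<phi>
  assumes \<phi>: "contact_hom M L \<phi>"
begin

lemma hom_maps: "\<phi> \<in> carrier M \<rightarrow> carrier L"
  and hom_sup: "A \<subseteq> carrier M \<Longrightarrow> \<phi> (\<Squnion>\<^bsub>M\<^esub>A) = \<Squnion>\<^bsub>L\<^esub>(\<phi> ` A)"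
  and hom_inf_pres: "inf_pres M L \<phi>"
  and hom_complement: "a \<in> carrier M \<Longrightarrow> \<phi> (complement M a) = complement L (\<phi> a)"
  and hom_contact: "\<lbrakk>a \<in> carrier M; b \<in> carrier M; contact L (\<phi> a) (\<phi> b)\<rbrakk> \<Longrightarrow> contact M a b"
  and hom_bounded: "u \<in> bounded_elems L \<Longrightarrow> left_adjoint M L \<phi> u \<in> bounded_elems M"
  using \<phi> unfolding contact_hom_def complete_boolean_hom_def sup_pres_def by auto

lemma hom_closed: "a \<in> carrier M \<Longrightarrow> \<phi> a \<in> carrier L"
  using hom_maps by blast

lemma hom_meet:
  assumes "a \<in> carrier M" "b \<in> carrier M"
  shows "\<phi> (a \<sqinter>\<^bsub>M\<^esub> b) = \<phi> a \<sqinter>\<^bsub>L\<^esub> \<phi> b"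
proof -
  have "{a, b} \<subseteq> carrier M" using assms by simp
  then have "\<phi> (\<Sqinter>\<^bsub>M\<^esub>{a, b}) = \<Sqinter>\<^bsub>L\<^esub>(\<phi> ` {a, b})"
    using hom_inf_pres unfolding inf_pres_def by blast
  then show ?thesis unfolding meet_def by simp
qed

lemma hom_bottom: "\<phi> \<bottom>\<^bsub>M\<^esub> = \<bottom>\<^bsub>L\<^esub>"
proof -
  have "\<Squnion>\<^bsub>M\<^esub>{} = \<bottom>\<^bsub>M\<^esub>" "\<Squnion>\<^bsub>L\<^esub>{} = \<bottom>\<^bsub>L\<^esub>"
    using Y.weak_sup_empty X.weak_sup_empty by (simp_all only: X.eq_is_equal Y.eq_is_equal)
  then show ?thesis using hom_sup[of "{}"] by simp
qed

text \<open>These are elements that have to contain the image of \<open>x\<close> under a map with dual \<open>\<phi>\<close>. They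
  form a filter base of nonempty closed sets.\<close>

definition family :: "'a \<Rightarrow> 'e set" where
  "family x = {a \<in> carrier M. x \<in> X interior_of (d (\<phi> a))}"

lemma family_meet: "\<lbrakk>a \<in> family x; b \<in> family x\<rbrakk> \<Longrightarrow> a \<sqinter>\<^bsub>M\<^esub> b \<in> family x"
  unfolding family_def by (simp add: hom_meet hom_closed X.interior_d_meet)

lemma family_nonempty: "a \<in> family x \<Longrightarrow> e a \<noteq> {}"
  unfolding family_def using Y.d_inject[of a "\<bottom>\<^bsub>M\<^esub>"] Y.d_bottom hom_bottom X.d_bottom by auto

text \<open>By L2, the left adjoint takes a compact neighbourhood of \<open>x\<close> to a compact member of the
  family. So the family has a common point by compactness.\<close>

lemma family_bounded:
  assumes x: "x \<in> topspace X"
  shows "\<exists>n \<in> family x. compactin Y (e n)"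
proof -
  obtain h where h: "h \<in> bounded_elems L" "h \<in> carrier L" "x \<in> X interior_of (d h)"
    using X.point_neighbourhood[OF openin_topspace x] by metis
  let ?n = "left_adjoint M L \<phi> h"
  have n: "?n \<in> bounded_elems M" using hom_bounded[OF h(1)] .
  then have nc: "?n \<in> carrier M" "compactin Y (e ?n)" unfolding Y.bounded_eq by auto
  have "h \<sqsubseteq>\<^bsub>L\<^esub> \<phi> ?n"
    using left_adjoint[OF Y.complete_lattice_L X.complete_lattice_L hom_maps hom_inf_pres h(2) nc(1)]
      nc(1) by simp
  then have "d h \<subseteq> d (\<phi> ?n)" using X.le_iff h(2) hom_closed nc(1) by simp
  then have "?n \<in> family x"
    unfolding family_def using h(3) nc(1) interior_of_mono[of "d h" "d (\<phi> ?n)" X] by blast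
  with nc(2) show ?thesis by blast
qed

lemma family_limit:
  assumes x: "x \<in> topspace X"
  shows "\<exists>y. y \<in> topspace Y \<and> (\<forall>a \<in> family x. y \<in> e a)"
proof -
  obtain n where n: "n \<in> family x" "compactin Y (e n)" using family_bounded[OF x] by blast
  have nc: "n \<in> carrier M" using n(1) unfolding family_def by simp
  have "e n \<inter> \<Inter>F \<noteq> {}" if F: "finite F" "F \<subseteq> e ` family x" for F
  proof -
    have "\<exists>a \<in> family x. e a \<subseteq> e n \<inter> \<Inter>F"
      using F
    proof (induction F rule: finite_induct)
      case empty
      then show ?case using n(1) by auto
    next
      case (insert K F)
      obtain a where a: "a \<in> family x" "e a \<subseteq> e n \<inter> \<Inter>F" using insert by auto
      obtain b where b: "b \<in> family x" "K = e b" using insert.prems by auto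
      have car: "a \<in> carrier M" "b \<in> carrier M" using a(1) b(1) unfolding family_def by auto
      have "e (a \<sqinter>\<^bsub>M\<^esub> b) \<subseteq> e a" "e (a \<sqinter>\<^bsub>M\<^esub> b) \<subseteq> e b"
        using Y.le_iff[of "a \<sqinter>\<^bsub>M\<^esub> b"] car Y.meet_left[OF car] Y.meet_right[OF car] by auto
      then have "e (a \<sqinter>\<^bsub>M\<^esub> b) \<subseteq> e n \<inter> \<Inter>(insert K F)" using a(2) b(2) by auto
      then show ?case using family_meet[OF a(1) b(1)] by blast
    qed
    then show ?thesis using family_nonempty by blast
  qed
  moreover have "closedin Y K" if "K \<in> e ` family x" for K
    using that Y.d_closed unfolding family_def by auto
  ultimately have "e n \<inter> \<Inter>(e ` family x) \<noteq> {}"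
    using n(2) unfolding compactin_fip by simp
  then obtain y where y: "y \<in> e n" "\<forall>a \<in> family x. y \<in> e a" by auto
  then have "y \<in> topspace Y" using Y.d_subset[OF nc] by auto
  with y(2) show ?thesis by blast
qed

definition point_map :: "'a \<Rightarrow> 'c" where
  "point_map = (\<lambda>x \<in> topspace X. SOME y. y \<in> topspace Y \<and> (\<forall>a \<in> family x. y \<in> e a))"

lemma
  assumes x: "x \<in> topspace X"
  shows point_map_closed: "point_map x \<in> topspace Y"
    and point_map_family: "a \<in> family x \<Longrightarrow> point_map x \<in> e a"
  using someI_ex[OF family_limit[OF x]] x unfolding point_map_def by auto

lemma point_map_in:
  "\<lbrakk>a \<in> carrier M; x \<in> X interior_of (d (\<phi> a))\<rbrakk> \<Longrightarrow> point_map x \<in> e a"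
  using point_map_family[of x a] interior_of_subset_topspace[of X] unfolding family_def by blast

lemma preimage_point_map_subset:
  assumes a: "a \<in> carrier M"
  shows "preimage_in X point_map (Y interior_of (e a)) \<subseteq> d (\<phi> a)"
proof (rule subsetI, rule ccontr)
  fix x assume "x \<in> preimage_in X point_map (Y interior_of (e a))" and "x \<notin> d (\<phi> a)"
  then have x: "x \<in> topspace X" "point_map x \<in> Y interior_of (e a)" "x \<in> topspace X - d (\<phi> a)" by auto
  have "x \<in> X interior_of (d (\<phi> (complement M a)))"
    using x(3) a by (simp add: hom_complement X.interior_d_complement hom_closed)
  then have "point_map x \<in> e (complement M a)" using a by (intro point_map_in) simp
  then show False using x(2) a by (simp add: Y.d_complement)
qed

text \<open>If \<open>a\<close> is well inside \<open>b\<close>, then by L1 the image of \<open>a\<close> is well inside the image of \<open>b\<close>. So a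
  neighbourhood \<open>b\<close> of the value at \<open>x\<close> has as image a neighbourhood of \<open>x\<close>, which is mapped
  into \<open>b\<close>.\<close>

lemma point_map_continuous: "continuous_map X Y point_map"
  unfolding continuous_map_def
proof (intro conjI allI impI)
  show "point_map \<in> topspace X \<rightarrow> topspace Y" using point_map_closed by blast
  fix U assume U: "openin Y U"
  have "\<exists>T. openin X T \<and> x \<in> T \<and> T \<subseteq> preimage_in X point_map U" if x: "x \<in> preimage_in X point_map U" for x
  proof -
    have xt: "x \<in> topspace X" "point_map x \<in> U" using x by auto
    obtain b where b: "b \<in> carrier M" "point_map x \<in> Y interior_of (e b)" "e b \<subseteq> U"
      using Y.point_neighbourhood[OF U xt(2)] by metis
    obtain a where a: "a \<in> carrier M" "point_map x \<in> Y interior_of (e a)" "e a \<subseteq> Y interior_of (e b)"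
      using Y.point_neighbourhood[OF openin_interior_of b(2)] by metis
    have "\<not> contact M a (complement M b)"
      using a(3) Y.contact_iff[OF a(1), of "complement M b"] b(1) by (auto simp: Y.d_complement)
    then have "\<not> contact L (\<phi> a) (complement L (\<phi> b))"
      using hom_contact[OF a(1), of "complement M b"] b(1) by (auto simp: hom_complement)
    then have "d (\<phi> a) \<inter> (topspace X - X interior_of (d (\<phi> b))) = {}"
      using X.contact_iff[of "\<phi> a" "complement L (\<phi> b)"] a(1) b(1) by (simp add: hom_closed X.d_complement)
    moreover have "x \<in> d (\<phi> a)" using preimage_point_map_subset[OF a(1)] xt(1) a(2) by blast
    ultimately have "x \<in> X interior_of (d (\<phi> b))" using xt(1) by blast
    moreover have "X interior_of (d (\<phi> b)) \<subseteq> preimage_in X point_map U"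
      using point_map_in[OF b(1)] b(3) interior_of_subset_topspace[of X "d (\<phi> b)"] by blast
    ultimately show ?thesis by (meson openin_interior_of)
  qed
  then show "openin X (preimage_in X point_map U)" by (subst openin_subopen) blast
qed

text \<open>The element \<open>s\<close> is the join of the elements inside \<open>V\<close>, and \<open>\<phi>\<close> preserves this join.\<close>

lemma hom_subset_closure_preimage:
  assumes V: "openin Y V" and s: "s \<in> carrier M" "e s = Y closure_of V"
  shows "d (\<phi> s) \<subseteq> X closure_of (preimage_in X point_map V)"
proof -
  define A where "A = {b \<in> carrier M. e b \<subseteq> V}"
  have A: "A \<subseteq> carrier M" unfolding A_def by blast
  then have im: "\<phi> ` A \<subseteq> carrier L" using hom_closed by blast
  have "(\<Union>b \<in> A. Y interior_of (e b)) = V"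
  proof (rule subset_antisym)
    show "(\<Union>b \<in> A. Y interior_of (e b)) \<subseteq> V"
      using interior_of_subset[of Y] unfolding A_def by blast
    show "V \<subseteq> (\<Union>b \<in> A. Y interior_of (e b))"
    proof
      fix y assume "y \<in> V"
      then obtain b where "b \<in> carrier M" "y \<in> Y interior_of (e b)" "e b \<subseteq> V"
        using Y.point_neighbourhood[OF V] by metis
      then show "y \<in> (\<Union>b \<in> A. Y interior_of (e b))" unfolding A_def by blast
    qed
  qed
  then have "s = \<Squnion>\<^bsub>M\<^esub>A" using s A by (intro Y.d_inject) (simp_all add: Y.d_sup)
  then have "d (\<phi> s) = X closure_of (\<Union>b \<in> \<phi> ` A. X interior_of (d b))"
    using hom_sup[OF A] X.d_sup[OF im] by simp
  also have "\<dots> \<subseteq> X closure_of (preimage_in X point_map V)"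
  proof (rule closure_of_mono)
    have "X interior_of (d (\<phi> b)) \<subseteq> preimage_in X point_map V" if "b \<in> A" for b
      using that point_map_in[of b] interior_of_subset_topspace[of X "d (\<phi> b)"] unfolding A_def by blast
    then show "(\<Union>b \<in> \<phi> ` A. X interior_of (d b)) \<subseteq> preimage_in X point_map V" by blast
  qed
  finally show ?thesis .
qed

lemma d_hom:
  assumes a: "a \<in> carrier M"
  shows "d (\<phi> a) = X closure_of (preimage_in X point_map (Y interior_of (e a)))"
proof (rule subset_antisym)
  show "d (\<phi> a) \<subseteq> X closure_of (preimage_in X point_map (Y interior_of (e a)))"
    using a by (intro hom_subset_closure_preimage) (simp_all add: Y.closure_interior_d)
  show "X closure_of (preimage_in X point_map (Y interior_of (e a))) \<subseteq> d (\<phi> a)"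
    by (rule closure_of_minimal[OF preimage_point_map_subset[OF a] X.d_closed[OF hom_closed[OF a]]])
qed

text \<open>A point outside \<open>\<phi> s\<close> has the image of the complement of \<open>s\<close> as a neighbourhood, and so is a
  limit of points that are mapped outside the closure of \<open>V\<close>.\<close>

lemma point_map_skeletal: "skeletal_map X Y point_map"
  unfolding skeletal_map_def
proof (intro conjI allI impI)
  show "point_map \<in> topspace X \<rightarrow> topspace Y" using point_map_closed by blast
  fix V assume V: "openin Y V"
  obtain s where s: "s \<in> carrier M" "e s = Y closure_of V"
    using Y.d_surj[OF regular_closed_closure[OF V]] .
  let ?O = "X interior_of (preimage_in X point_map (Y closure_of V))"
  have "?O \<subseteq> d (\<phi> s)"
  proof (rule subsetI, rule ccontr)
    fix x assume x: "x \<in> ?O" "x \<notin> d (\<phi> s)"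
    have "x \<in> X interior_of (d (\<phi> (complement M s)))"
      using x s(1) interior_of_subset_topspace[of X "preimage_in X point_map (Y closure_of V)"]
      by (auto simp: hom_complement X.interior_d_complement hom_closed)
    then have "x \<in> X closure_of (preimage_in X point_map (topspace Y - e s))"
      using interior_of_subset[of X "d (\<phi> (complement M s))"] d_hom[of "complement M s"] s(1)
      by (auto simp: Y.interior_d_complement)
    then obtain z where "z \<in> preimage_in X point_map (topspace Y - e s)" "z \<in> ?O"
      using x(1) unfolding in_closure_of by (meson openin_interior_of)
    then show False
      using interior_of_subset[of X "preimage_in X point_map (Y closure_of V)"] s(2) by blast
  qed
  also have "\<dots> \<subseteq> X closure_of (preimage_in X point_map V)"
    by (rule hom_subset_closure_preimage[OF V s])
  finally show "?O \<subseteq> X closure_of (preimage_in X point_map V)" .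
qed

lemma hom_is_dual: "dual point_map = \<phi>"
  using \<phi> unfolding contact_hom_def
  by (intro dual_eqI point_map_continuous) (simp_all add: hom_closed d_hom)

end

theorem dual_surjective:
  assumes "contact_hom M L \<phi>"
  shows "\<exists>f \<in> extensional (topspace X). continuous_map X Y f \<and> skeletal_map X Y f \<and> dual f = \<phi>"
proof
  show "point_map \<phi> \<in> extensional (topspace X)" unfolding point_map_def[OF assms] by simp
  show "continuous_map X Y (point_map \<phi>) \<and> skeletal_map X Y (point_map \<phi>) \<and> dual (point_map \<phi>) = \<phi>"
    using point_map_continuous[OF assms] point_map_skeletal[OF assms] hom_is_dual[OF assms] by blast
qed

end

section \<open>The two categories\<close>

lemma SkeLC_simps [simp]:
  "X \<in> Ob (SkeLC r) \<longleftrightarrow> locally_compact_space X \<and> Hausdorff_space X \<and> |regular_closed_sets X| <o r"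
  "f \<in> Hom (SkeLC r) X Y \<longleftrightarrow> f \<in> extensional (topspace X) \<and> continuous_map X Y f \<and> skeletal_map X Y f"
  "Idt (SkeLC r) X = (\<lambda>x \<in> topspace X. x)"
  "Cmp (SkeLC r) X Y Z g f = compose (topspace X) g f"
  by (simp_all add: SkeLC_def)

lemma DSkeLC_simps [simp]:
  "A \<in> Ob (DSkeLC r) \<longleftrightarrow> complete_local_contact_algebra A \<and> |carrier A| <o r"
  "\<phi> \<in> Hom (DSkeLC r) A B \<longleftrightarrow> contact_hom A B \<phi>"
  "Idt (DSkeLC r) A = (\<lambda>a \<in> carrier A. a)"
  "Cmp (DSkeLC r) A B D \<psi> \<phi> = compose (carrier A) \<psi> \<phi>"
  by (simp_all add: DSkeLC_def contact_hom_def)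

lemma opposite_simps [simp]:
  "Ob (opposite C) = Ob C" "Hom (opposite C) X Y = Hom C Y X" "Idt (opposite C) = Idt C"
  "Cmp (opposite C) X Y Z g f = Cmp C Z Y X f g"
  by (simp_all add: opposite_def)

lemma category_opposite:
  assumes "category C"
  shows "category (opposite C)"
proof -
  interpret category C by fact
  show ?thesis
    by unfold_locales (simp_all add: id_in_Hom comp_in_Hom comp_id_right comp_id_left comp_assoc)
qed

lemma compose_restrict_id:
  "f \<in> extensional A \<Longrightarrow> compose A f (\<lambda>x \<in> A. x) = f"
  "\<lbrakk>f \<in> extensional A; f \<in> A \<rightarrow> B\<rbrakk> \<Longrightarrow> compose A (\<lambda>x \<in> B. x) f = f"
  by (rule extensionalityI[where A = A]; force simp: compose_def)+

lemma category_SkeLC: "category (SkeLC r)"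
proof
  fix X assume "X \<in> Ob (SkeLC r)"
  have "continuous_map X X (\<lambda>x \<in> topspace X. x)"
    by (rule continuous_map_eq[OF continuous_map_id]) simp
  then show "Idt (SkeLC r) X \<in> Hom (SkeLC r) X X" by (simp add: skeletal_map_id)
next
  fix X Y Z f g assume fg: "f \<in> Hom (SkeLC r) X Y" "g \<in> Hom (SkeLC r) Y Z"
  then have "continuous_map X Z (g \<circ> f)" using continuous_map_compose by auto
  then have "continuous_map X Z (compose (topspace X) g f)"
    by (rule continuous_map_eq) (simp add: compose_eq)
  then show "Cmp (SkeLC r) X Y Z g f \<in> Hom (SkeLC r) X Z"
    using fg skeletal_map_compose[of X Y f Z g] by (simp add: compose_def)
next
  fix X Y f assume "f \<in> Hom (SkeLC r) X Y"
  then show "Cmp (SkeLC r) X X Y f (Idt (SkeLC r) X) = f" "Cmp (SkeLC r) X Y Y (Idt (SkeLC r) Y) f = f"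
    by (simp_all add: compose_restrict_id skeletal_map_def)
next
  fix W X Y Z f g h assume "f \<in> Hom (SkeLC r) W X"
  then have "f \<in> topspace W \<rightarrow> topspace X" by (simp add: skeletal_map_def)
  then show "Cmp (SkeLC r) W X Z (Cmp (SkeLC r) X Y Z h g) f = Cmp (SkeLC r) W Y Z h (Cmp (SkeLC r) W X Y g f)"
    by (simp add: compose_assoc)
qed

lemma contact_homD:
  assumes "contact_hom A B \<phi>"
  shows "\<phi> \<in> extensional (carrier A)" "\<phi> \<in> carrier A \<rightarrow> carrier B" "complete_lattice A" "complete_lattice B"
    "inf_pres A B \<phi>" "sup_pres A B \<phi>"
  using assms unfolding contact_hom_def complete_boolean_hom_def sup_pres_def by auto

lemma contact_hom_id:
  assumes A: "complete_local_contact_algebra A"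
  shows "contact_hom A A (\<lambda>a \<in> carrier A. a)"
proof -
  interpret complete_local_contact_algebra A by fact
  define i where "i = (\<lambda>a \<in> carrier A. a)"
  have i: "i a = a" if "a \<in> carrier A" for a using that by (simp add: i_def)
  have im: "i ` S = S" if S: "S \<subseteq> carrier A" for S
  proof -
    have "i ` S = (\<lambda>a. a) ` S" by (rule image_cong) (use S i in auto)
    then show ?thesis by simp
  qed
  have "left_adjoint A A i b = b" if "b \<in> bounded_elems A" for b
    using that i by (intro left_adjoint_eqI partial_order_axioms) simp_all
  moreover have "i \<in> extensional (carrier A)" by (simp add: i_def)
  ultimately have "contact_hom A A i"
    unfolding contact_hom_def complete_boolean_hom_def sup_pres_def inf_pres_def
    using complete_lattice_axioms by (simp add: im i)
  then show ?thesis unfolding i_def .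
qed

lemma contact_hom_compose:
  assumes \<phi>: "contact_hom A B \<phi>" and \<psi>: "contact_hom B D \<psi>" 
    and "complete_local_contact_algebra A" "complete_local_contact_algebra D"
  shows "contact_hom A D (compose (carrier A) \<psi> \<phi>)"
proof -
  note P = contact_homD[OF \<phi>] and Q = contact_homD[OF \<psi>]
  interpret A: complete_local_contact_algebra A by fact
  interpret D: complete_local_contact_algebra D by fact
  have D: "bounded_elems D \<subseteq> carrier D" using D.bounded_closed by blast
  have PB: "\<phi> a \<in> carrier B" if "a \<in> carrier A" for a using P(2) that by blast
  have im: "compose (carrier A) \<psi> \<phi> ` S = \<psi> ` \<phi> ` S" "\<phi> ` S \<subseteq> carrier B" if "S \<subseteq> carrier A" for S
    using that PB by (auto simp: compose_def image_image intro!: image_cong)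
  have sup: "sup_pres A D (compose (carrier A) \<psi> \<phi>)"
    using P(6) Q(6) im A.sup_closed unfolding sup_pres_def by (simp add: compose_eq)
  have inf: "inf_pres A D (compose (carrier A) \<psi> \<phi>)"
    using P(5) Q(5) im A.inf_closed unfolding inf_pres_def by (simp add: compose_eq)
  have compl: "\<phi> (complement A a) = complement B (\<phi> a)" if "a \<in> carrier A" for a
    using \<phi> that unfolding contact_hom_def complete_boolean_hom_def by blast
  have A_complement: "complement A a \<in> carrier A" if "a \<in> carrier A" for a
    using A.complement_closed that .
  have compl': "\<psi> (complement B b) = complement D (\<psi> b)" if "b \<in> carrier B" for b
    using \<psi> that unfolding contact_hom_def complete_boolean_hom_def by blast
  have adj: "left_adjoint A D (compose (carrier A) \<psi> \<phi>) u = left_adjoint A B \<phi> (left_adjoint B D \<psi> u)"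
    if u: "u \<in> carrier D" for u
  proof (rule left_adjoint_eqI[OF A.partial_order_axioms])
    have v: "left_adjoint B D \<psi> u \<in> carrier B"
      by (rule left_adjoint_closed[OF Q(3,4,2,5) u])
    show "left_adjoint A B \<phi> (left_adjoint B D \<psi> u) \<in> carrier A"
      by (rule left_adjoint_closed[OF P(3,4,2,5) v])
    show "u \<sqsubseteq>\<^bsub>D\<^esub> compose (carrier A) \<psi> \<phi> a
        \<longleftrightarrow> left_adjoint A B \<phi> (left_adjoint B D \<psi> u) \<sqsubseteq>\<^bsub>A\<^esub> a" if a: "a \<in> carrier A" for a
      using left_adjoint[OF Q(3,4,2,5) u PB[OF a]] left_adjoint[OF P(3,4,2,5) v a] a
      by (simp add: compose_eq)
  qed
  show ?thesis
    unfolding contact_hom_def complete_boolean_hom_def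
  proof (intro conjI ballI impI sup inf)
    show "compose (carrier A) \<psi> \<phi> \<in> carrier A \<rightarrow> carrier D"
      using PB Q(2) by (auto simp: compose_eq)
    show "compose (carrier A) \<psi> \<phi> (complement A a) = complement D (compose (carrier A) \<psi> \<phi> a)"
      if "a \<in> carrier A" for a
      using that compl compl' PB A_complement by (simp add: compose_eq)
    show "contact A a b" if "a \<in> carrier A" "b \<in> carrier A"
      "contact D (compose (carrier A) \<psi> \<phi> a) (compose (carrier A) \<psi> \<phi> b)" for a b
      using that PB \<phi> \<psi> unfolding contact_hom_def by (simp add: compose_eq)
    show "left_adjoint A D (compose (carrier A) \<psi> \<phi>) u \<in> bounded_elems A" if u: "u \<in> bounded_elems D" for u
      using adj[OF subsetD[OF D u]] u \<phi> \<psi> unfolding contact_hom_def by simp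
  qed (simp add: compose_def)
qed

lemma category_DSkeLC: "category (DSkeLC r)"
proof
  fix A assume "A \<in> Ob (DSkeLC r)"
  then show "Idt (DSkeLC r) A \<in> Hom (DSkeLC r) A A" by (simp add: contact_hom_id)
next
  fix A B D \<phi> \<psi>
  assume *: "A \<in> Ob (DSkeLC r)" "D \<in> Ob (DSkeLC r)" "\<phi> \<in> Hom (DSkeLC r) A B" "\<psi> \<in> Hom (DSkeLC r) B D"
  show "Cmp (DSkeLC r) A B D \<psi> \<phi> \<in> Hom (DSkeLC r) A D"
    using * contact_hom_compose[of A B \<phi> D \<psi>] by auto
next
  fix A B \<phi> assume "\<phi> \<in> Hom (DSkeLC r) A B"
  then show "Cmp (DSkeLC r) A A B \<phi> (Idt (DSkeLC r) A) = \<phi>" "Cmp (DSkeLC r) A B B (Idt (DSkeLC r) B) \<phi> = \<phi>"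
    using contact_homD(1,2)[of A B \<phi>] by (simp_all add: compose_restrict_id)
next
  fix A B D E \<phi> \<psi> \<theta> assume "\<phi> \<in> Hom (DSkeLC r) A B"
  then have "\<phi> \<in> carrier A \<rightarrow> carrier B" using contact_homD(2)[of A B \<phi>] by simp
  then show "Cmp (DSkeLC r) A B E (Cmp (DSkeLC r) B D E \<theta> \<psi>) \<phi>
      = Cmp (DSkeLC r) A D E \<theta> (Cmp (DSkeLC r) A B D \<psi> \<phi>)"
    by (simp add: compose_assoc)
qed

section \<open>The duality\<close>

text \<open>The algebra of regular closed sets of a space is copied to the type \<open>'u\<close> by an injection,
  which exists for the spaces in \<open>SkeLC r\<close> by the size condition.\<close>

definition code :: "'a topology \<Rightarrow> 'a set \<Rightarrow> 'u" where
  "code X = (SOME h. inj_on h (regular_closed_sets X))"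

definition decode :: "'a topology \<Rightarrow> 'u \<Rightarrow> 'a set" where
  "decode X = inv_into (regular_closed_sets X) (code X)"

definition algebra_of :: "'a topology \<Rightarrow> 'u local_contact_lattice" where
  "algebra_of X = \<lparr>carrier = code X ` regular_closed_sets X, eq = (=),
     le = (\<lambda>a b. decode X a \<subseteq> decode X b),
     contact = (\<lambda>a b. decode X a \<inter> decode X b \<noteq> {}),
     bounded_elems = {a \<in> code X ` regular_closed_sets X. compactin X (decode X a)}\<rparr>"

lemma inj_code:
  fixes r :: "'u rel"
  assumes "Card_order r" "|regular_closed_sets X| <o r"
  shows "inj_on (code X :: _ \<Rightarrow> 'u) (regular_closed_sets X)"
proof -
  have "|regular_closed_sets X| \<le>o |Field r|"
    using ordLess_imp_ordLeq[OF assms(2)] ordIso_symmetric[OF card_of_Field_ordIso[OF assms(1)]]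
    by (rule ordLeq_ordIso_trans)
  then have "\<exists>h :: _ \<Rightarrow> 'u. inj_on h (regular_closed_sets X)"
    unfolding card_of_ordLeq[symmetric] by blast
  then show ?thesis unfolding code_def by (rule someI_ex)
qed

lemma algebra_of_representation:
  fixes r :: "'u rel"
  assumes r: "Card_order r" and X: "X \<in> Ob (SkeLC r)"
  shows "locally_compact_representation X (algebra_of X :: 'u local_contact_lattice) (decode X)"
    and "(algebra_of X :: 'u local_contact_lattice) \<in> Ob (DSkeLC r)"
proof -
  let ?L = "algebra_of X :: 'u local_contact_lattice"
  have inj: "inj_on (code X :: _ \<Rightarrow> 'u) (regular_closed_sets X)"
    using inj_code[OF r, of X] X by simp
  interpret locally_compact_representation X ?L "decode X"
  proof
    show "bij_betw (decode X) (carrier ?L) (regular_closed_sets X)"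
      using bij_betw_inv_into[OF inj_on_imp_bij_betw[OF inj]] unfolding decode_def algebra_of_def by simp
  qed (use X in \<open>simp_all add: algebra_of_def\<close>)
  show "locally_compact_representation X ?L (decode X)" by unfold_locales
  have "|carrier ?L| <o r"
    using X ordLeq_ordLess_trans[OF card_of_image] unfolding algebra_of_def by auto
  then show "?L \<in> Ob (DSkeLC r)" by (simp add: complete_local_contact_algebra_L)
qed

definition duality ::
  "('u set topology, 'u set \<Rightarrow> 'u set, 'u local_contact_lattice, 'u \<Rightarrow> 'u) cfunctor" where
  "duality = \<lparr>fob = algebra_of,
     fmor = (\<lambda>X Y. dual_map X (algebra_of X) (decode X) Y (algebra_of Y) (decode Y))\<rparr>"

text \<open>Duals compose contravariantly whatever the representations are. So the identity map of \<open>X\<close>, read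
  between the two representations in both directions, has mutually inverse duals.\<close>

lemma representations_isomorphic:
  assumes L: "locally_compact_representation X L d" and M: "locally_compact_representation X M e"
  shows "Iso (opposite (DSkeLC r)) L M \<noteq> {}"
proof -
  interpret fwd: representation_pair X L d X M e using L M by (rule representation_pair.intro)
  interpret bwd: representation_pair X M e X L d using M L by (rule representation_pair.intro)
  let ?id = "\<lambda>x \<in> topspace X. x"
  have id: "continuous_map X X ?id" "skeletal_map X X ?id" "compose (topspace X) ?id ?id = ?id"
    using continuous_map_eq[OF continuous_map_id, of X ?id] skeletal_map_id
    by (auto simp: compose_def)
  have "compose (carrier L) (fwd.dual ?id) (bwd.dual ?id) = (\<lambda>a \<in> carrier L. a)"
    "compose (carrier M) (bwd.dual ?id) (fwd.dual ?id) = (\<lambda>a \<in> carrier M. a)"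
    using dual_map_compose[OF L M L id(1,2) id(1,2)] dual_map_compose[OF M L M id(1,2) id(1,2)] id(3)
      dual_map_id[OF fwd.X.regular_closed_representation_axioms]
      dual_map_id[OF fwd.Y.regular_closed_representation_axioms] by simp_all
  then have "fwd.dual ?id \<in> Iso (opposite (DSkeLC r)) L M"
    unfolding Iso_def using fwd.dual_contact_hom[OF id(1,2)] bwd.dual_contact_hom[OF id(1,2)] by auto
  then show ?thesis by blast
qed

lemma duality_fully_faithful_dense:
  fixes r :: "'u rel"
  assumes r: "Card_order r"
  shows "fully_faithful_dense (SkeLC r) (opposite (DSkeLC r)) duality"
proof -
  let ?A = "algebra_of :: 'u set topology \<Rightarrow> 'u local_contact_lattice"
  note rep = algebra_of_representation(1)[OF r] and obj = algebra_of_representation(2)[OF r]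
  have pair: "representation_pair X (?A X) (decode X) Y (?A Y) (decode Y)"
    if "X \<in> Ob (SkeLC r)" "Y \<in> Ob (SkeLC r)" for X Y
    using rep that by (intro representation_pair.intro)
  show ?thesis
  proof (intro fully_faithful_dense.intro fully_faithful_dense_axioms.intro
      category_SkeLC category_opposite category_DSkeLC)
    show "is_functor (SkeLC r) (opposite (DSkeLC r)) duality"
      unfolding is_functor_def
    proof (intro conjI ballI)
      fix X assume X: "X \<in> Ob (SkeLC r)"
      show "fob duality X \<in> Ob (opposite (DSkeLC r))"
        using obj[OF X] by (simp add: duality_def)
      interpret locally_compact_representation X "?A X" "decode X" by (rule rep[OF X])
      show "fmor duality X X (Idt (SkeLC r) X) = Idt (opposite (DSkeLC r)) (fob duality X)"
        using dual_map_id[OF regular_closed_representation_axioms] by (simp add: duality_def)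
    next
      fix X Y f assume *: "X \<in> Ob (SkeLC r)" "Y \<in> Ob (SkeLC r)" "f \<in> Hom (SkeLC r) X Y"
      then show "fmor duality X Y f \<in> Hom (opposite (DSkeLC r)) (fob duality X) (fob duality Y)"
        using representation_pair.dual_contact_hom[OF pair[OF *(1,2)]] by (simp add: duality_def)
    next
      fix X Y Z f g
      assume *: "X \<in> Ob (SkeLC r)" "Y \<in> Ob (SkeLC r)" "Z \<in> Ob (SkeLC r)"
        "f \<in> Hom (SkeLC r) X Y" "g \<in> Hom (SkeLC r) Y Z"
      then show "fmor duality X Z (Cmp (SkeLC r) X Y Z g f)
        = Cmp (opposite (DSkeLC r)) (fob duality X) (fob duality Y) (fob duality Z)
            (fmor duality Y Z g) (fmor duality X Y f)"
        using dual_map_compose[OF rep[OF *(1)] rep[OF *(2)] rep[OF *(3)]] by (simp add: duality_def)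
    qed
  next
    fix X Y f g
    assume *: "X \<in> Ob (SkeLC r)" "Y \<in> Ob (SkeLC r)" "f \<in> Hom (SkeLC r) X Y" "g \<in> Hom (SkeLC r) X Y"
      and eq: "fmor duality X Y f = fmor duality X Y g"
    show "f = g"
      by (rule extensionalityI[where A = "topspace X"])
        (use * eq representation_pair.dual_inject[OF pair[OF *(1,2)], of f g] in
          \<open>simp_all add: duality_def\<close>)
  next
    fix X Y \<phi>
    assume *: "X \<in> Ob (SkeLC r)" "Y \<in> Ob (SkeLC r)"
      and \<phi>: "\<phi> \<in> Hom (opposite (DSkeLC r)) (fob duality X) (fob duality Y)"
    then show "\<exists>f \<in> Hom (SkeLC r) X Y. fmor duality X Y f = \<phi>"
      using representation_pair.dual_surjective[OF pair[OF *], of \<phi>] by (auto simp: duality_def)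
  next
    fix L :: "'u local_contact_lattice" assume L: "L \<in> Ob (opposite (DSkeLC r))"
    then interpret complete_local_contact_algebra L by simp
    interpret locally_compact_representation space L extent
      by (intro locally_compact_representation.intro locally_compact_representation_axioms.intro
          representation locally_compact_space_points Hausdorff_space_points)
    have "|regular_closed_sets space| <o r"
      by (rule ordIso_ordLess_trans[OF ordIso_symmetric[OF card_of_ordIsoI[OF bij]]]) (use L in simp)
    then have X: "space \<in> Ob (SkeLC r)"
      using locally_compact Hausdorff by simp
    have "Iso (opposite (DSkeLC r)) (?A space) L \<noteq> {}"
      by (rule representations_isomorphic[OF rep[OF X] locally_compact_representation_axioms])
    then show "\<exists>X \<in> Ob (SkeLC r). Iso (opposite (DSkeLC r)) (fob duality X) L \<noteq> {}"
      using X by (auto simp: duality_def)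
  qed
qed

theorem theorem2p11:
  fixes r :: "'u rel"
  assumes "Card_order r"
  shows "dually_equivalent (SkeLC r) (DSkeLC r)"
  unfolding dually_equivalent_def
  by (rule fully_faithful_dense.equivalent[OF duality_fully_faithful_dense[OF assms]])

end
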